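(* Let the dynamical conductances $b_t(x)$ satisfy the standing assumption in the context and $\mathbb E[b_0(0)]<\infty$, $\mathbb E[b_0(0)^{-1}]<\infty$. With $K$ and $\varphi$ as in the context, let $$\chi(t,0):=-\int_0^tds\,\bigl(b_s(0)\,\varphi\circ\tau_{s,0}-b_s(-1)\,\varphi\circ\tau_{s,-1}\bigr),\quad t\ge0.$$ Then for each $t\ge0$, $\mathbb P$-a.s., $$\chi(t,0)=\sum_{x<0}\sum_{y\ge0}\varphi\circ\tau_{t,x}\,K(t,x;0,y)-\sum_{x\ge0}\sum_{y<0}\varphi\circ\tau_{t,x}\,K(t,x;0,y),$$ where each of the double sums converges to a finite number $\mathbb P$-a.s.
   Context: Standing assumption. $(\Omega,\mathcal F,\mathbb P)$ is a probability space with expectation $\mathbb E$. For each $t\in\mathbb R$, $x\in\mathbb Z$, the conductance $b_t(x)$ is a function $\Omega\to(0,\infty)$; for each $x$ the map $(t,\omega)\mapsto b_t(x)$ is $\mathcal B(\mathbb R)\otimes\mathcal F$-measurable and locally Lebesgue integrable in $t$. There are space-time shifts $\tau_{t,x}\colon\Omega\to\Omega$, $t\in\mathbb R$, $x\in\mathbb Z$ (a jointly measurable action of $\mathbb R\times\mathbb Z$), with $b_s(y)\circ\tau_{t,x}=b_{s+t}(y+x)$. $\mathbb P$ is invariant and ergodic with respect to $\{\tau_{t,x}\}$. For a random variable $f$, $f\circ\tau_{t,x}$ denotes $\omega\mapsto f(\tau_{t,x}\omega)$. Dual walk kernel. For reals $t\le s$ and $x,y\in\mathbb Z$, set $K_0:=0$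 and inductively $$K_{n+1}(s,x;t,y):=e^{-\int_t^s2b_u(x)du}\delta_{x,y}+\int_t^sdr\,e^{-\int_r^s2b_u(x)du}\,b_r(x)\sum_{z=\pm1}K_n(r,x+z;t,y).$$ $K_n$ is non-decreasing in $n$ with values in $[0,1]$; $K:=\lim_{n\to\infty}K_n$. The function $\varphi$. Put $\varphi_\epsilon:=\epsilon\int_0^\infty dt\,e^{-\epsilon t}\sum_{y\in\mathbb Z}K(t,y;0,0)$ for $\epsilon>0$. $\varphi$ is a measurable function on $\Omega$ for which there is a sequence $\epsilon_k\downarrow0$ with $\mathbb E(\varphi_{\epsilon_k}f)\to\mathbb E(\varphi f)$ for every measurable $f$ with $\mathbb E(b_0(0)^{-1}f^2)<\infty$; such $\varphi$ exists and satisfies $\varphi>0$ a.s., $\mathbb E\varphi=1$, $\mathbb E(b_0(0)\varphi^2)\le\mathbb E(b_0(0))$ and $\varphi=\sum_x\varphi\circ\tau_{t,x}K(t,x;0,0)$ a.s. for each $t>0$. The version of $\varphi$ is chosen so that, on a set of full $\mathbb P$-measure, for all $x\in\mathbb Z$ the map $t\mapsto\varphi\circ\tau_{t,x}$ is continuous and satisfies, in time-integrated form, $\frac{\partial}{\partial t}\varphi\circ\tau_{t,x}=-b_t(x+1)\varphi\circ\tau_{t,x+1}-b_t(x-1)\varphi\circ\tau_{t,x-1}+2b_t(x)\varphi\circ\tau_{t,x}$. *)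

theory Defs
  imports "HOL-Probability.Probability"
begin

locale dynamical_conductances = prob_space M
  for M :: "'a measure" and b :: "real \<Rightarrow> int \<Rightarrow> 'a \<Rightarrow> real" and \<tau> :: "real \<Rightarrow> int \<Rightarrow> 'a \<Rightarrow> 'a" +
  assumes conductance_pos: "\<And>t x \<omega>. \<omega> \<in> space M \<Longrightarrow> 0 < b t x \<omega>"
    and conductance_measurable: "\<And>x. (\<lambda>(t, \<omega>). b t x \<omega>) \<in> borel_measurable (borel \<Otimes>\<^sub>M M)"
    and conductance_locally_integrable:
      "\<And>s t x \<omega>. \<omega> \<in> space M \<Longrightarrow> set_integrable lborel {s..t} (\<lambda>u. b u x \<omega>)"
    and shift_measurable:
      "(\<lambda>(t, x, \<omega>). \<tau> t x \<omega>) \<in> measurable (borel \<Otimes>\<^sub>M count_space UNIV \<Otimes>\<^sub>M M) M"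
    and shift_zero: "\<And>\<omega>. \<omega> \<in> space M \<Longrightarrow> \<tau> 0 0 \<omega> = \<omega>"
    and shift_add: "\<And>s t x y \<omega>. \<omega> \<in> space M \<Longrightarrow> \<tau> s y (\<tau> t x \<omega>) = \<tau> (s + t) (y + x) \<omega>"
    and conductance_shift: "\<And>s t x y \<omega>. \<omega> \<in> space M \<Longrightarrow> b s y (\<tau> t x \<omega>) = b (s + t) (y + x) \<omega>"
    and shift_invariant: "\<And>t x. distr M M (\<tau> t x) = M"
    and shift_ergodic:
      "\<And>A. A \<in> sets M \<Longrightarrow> (\<And>t x. \<tau> t x -` A \<inter> space M = A) \<Longrightarrow> prob A = 0 \<or> prob A = 1"

text \<open>\<open>dual_kernel_approx b \<omega> n s x t y\<close> and \<open>dual_kernel b \<omega> s x t y\<close> are the kernels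
  $K_n(s,x;t,y)$ and $K(s,x;t,y)$ in the environment \<open>\<omega>\<close>; they are meant for \<open>t \<le> s\<close>.\<close>

primrec dual_kernel_approx ::
    "(real \<Rightarrow> int \<Rightarrow> 'a \<Rightarrow> real) \<Rightarrow> 'a \<Rightarrow> nat \<Rightarrow> real \<Rightarrow> int \<Rightarrow> real \<Rightarrow> int \<Rightarrow> real" where
  "dual_kernel_approx b \<omega> 0 s x t y = 0"
| "dual_kernel_approx b \<omega> (Suc n) s x t y =
     exp (- (LBINT u:{t..s}. 2 * b u x \<omega>)) * (if x = y then 1 else 0) +
     (LBINT r:{t..s}. exp (- (LBINT u:{r..s}. 2 * b u x \<omega>)) * b r x \<omega> *
        (\<Sum>z\<in>{1, -1}. dual_kernel_approx b \<omega> n r (x + z) t y))"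

definition dual_kernel ::
    "(real \<Rightarrow> int \<Rightarrow> 'a \<Rightarrow> real) \<Rightarrow> 'a \<Rightarrow> real \<Rightarrow> int \<Rightarrow> real \<Rightarrow> int \<Rightarrow> real" where
  "dual_kernel b \<omega> s x t y = lim (\<lambda>n. dual_kernel_approx b \<omega> n s x t y)"

text \<open>The approximation $\varphi_\epsilon$ is finite only almost surely, so it is first defined with
  values in $[0,\infty]$.\<close>

definition phi_approx :: "(real \<Rightarrow> int \<Rightarrow> 'a \<Rightarrow> real) \<Rightarrow> real \<Rightarrow> 'a \<Rightarrow> ennreal" where
  "phi_approx b \<epsilon> \<omega> = ennreal \<epsilon> *
     (\<integral>\<^sup>+t\<in>{0..}. ennreal (exp (- \<epsilon> * t)) * (\<Sum>\<^sub>\<infinity>y\<in>UNIV. ennreal (dual_kernel b \<omega> t y 0 0)) \<partial>lborel)"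

definition phi_weak_limit ::
    "'a measure \<Rightarrow> (real \<Rightarrow> int \<Rightarrow> 'a \<Rightarrow> real) \<Rightarrow> ('a \<Rightarrow> real) \<Rightarrow> bool" where
  "phi_weak_limit M b \<phi> \<longleftrightarrow>
     (\<exists>\<epsilon> :: nat \<Rightarrow> real. (\<forall>k. 0 < \<epsilon> k) \<and> decseq \<epsilon> \<and> \<epsilon> \<longlonglongrightarrow> 0 \<and>
        (\<forall>f \<in> borel_measurable M. integrable M (\<lambda>\<omega>. inverse (b 0 0 \<omega>) * (f \<omega>)\<^sup>2) \<longrightarrow>
           (\<forall>k. integrable M (\<lambda>\<omega>. enn2real (phi_approx b (\<epsilon> k) \<omega>) * f \<omega>)) \<and>
           integrable M (\<lambda>\<omega>. \<phi> \<omega> * f \<omega>) \<and>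
           (\<lambda>k. \<integral>\<omega>. enn2real (phi_approx b (\<epsilon> k) \<omega>) * f \<omega> \<partial>M)
             \<longlonglongrightarrow> (\<integral>\<omega>. \<phi> \<omega> * f \<omega> \<partial>M)))"

text \<open>Weak limits exist and have the properties in the clauses from positivity to the
  \<open>has_sum\<close> identity. The last clause fixes the version of \<open>\<phi>\<close>; its differential equation in \<open>t\<close>
  is stated in time-integrated form.\<close>

definition phi_density ::
    "'a measure \<Rightarrow> (real \<Rightarrow> int \<Rightarrow> 'a \<Rightarrow> real) \<Rightarrow> (real \<Rightarrow> int \<Rightarrow> 'a \<Rightarrow> 'a) \<Rightarrow> ('a \<Rightarrow> real) \<Rightarrow> bool" where
  "phi_density M b \<tau> \<phi> \<longleftrightarrow>
     \<phi> \<in> borel_measurable M \<and>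
     phi_weak_limit M b \<phi> \<and>
     (AE \<omega> in M. 0 < \<phi> \<omega>) \<and>
     integrable M \<phi> \<and> (\<integral>\<omega>. \<phi> \<omega> \<partial>M) = 1 \<and>
     integrable M (\<lambda>\<omega>. b 0 0 \<omega> * (\<phi> \<omega>)\<^sup>2) \<and>
     (\<integral>\<omega>. b 0 0 \<omega> * (\<phi> \<omega>)\<^sup>2 \<partial>M) \<le> (\<integral>\<omega>. b 0 0 \<omega> \<partial>M) \<and>
     (\<forall>t>0. AE \<omega> in M. ((\<lambda>x. \<phi> (\<tau> t x \<omega>) * dual_kernel b \<omega> t x 0 0) has_sum \<phi> \<omega>) UNIV) \<and>
     (AE \<omega> in M. \<forall>x.
        continuous_on UNIV (\<lambda>t. \<phi> (\<tau> t x \<omega>)) \<and>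
        (\<forall>s t. s \<le> t \<longrightarrow>
           \<phi> (\<tau> t x \<omega>) - \<phi> (\<tau> s x \<omega>) =
           (LBINT u:{s..t}. - b u (x + 1) \<omega> * \<phi> (\<tau> u (x + 1) \<omega>)
                            - b u (x - 1) \<omega> * \<phi> (\<tau> u (x - 1) \<omega>)
                            + 2 * b u x \<omega> * \<phi> (\<tau> u x \<omega>))))"

definition chi ::
    "(real \<Rightarrow> int \<Rightarrow> 'a \<Rightarrow> real) \<Rightarrow> (real \<Rightarrow> int \<Rightarrow> 'a \<Rightarrow> 'a) \<Rightarrow> ('a \<Rightarrow> real) \<Rightarrow> real \<Rightarrow> 'a \<Rightarrow> real" where
  "chi b \<tau> \<phi> t \<omega> =
     - (LBINT s:{0..t}. b s 0 \<omega> * \<phi> (\<tau> s 0 \<omega>) - b s (-1) \<omega> * \<phi> (\<tau> s (-1) \<omega>))"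

end

theory Submission
  imports Defs
begin

text \<open>
  Write \<open>f\<^sub>s(x) = b\<^sub>s(x) \<phi>\<circ>\<tau>\<^bsub>s,x\<^esub>\<close>. Along almost every environment \<open>\<phi>\<circ>\<tau>\<close> solves
  \<open>\<partial>\<^sub>s \<phi>\<circ>\<tau>\<^bsub>s,x\<^esub> = - f\<^sub>s(x+1) - f\<^sub>s(x-1) + 2 f\<^sub>s(x)\<close>, while for every set \<open>Y\<close> of sites the mass
  \<open>u\<^sub>s(x) = \<Sum>\<^bsub>y\<in>Y\<^esub> K(s,x;0,y)\<close> solves the adjoint equation
  \<open>\<partial>\<^sub>s u\<^sub>s(x) = b\<^sub>s(x) (u\<^sub>s(x+1) + u\<^sub>s(x-1) - 2 u\<^sub>s(x))\<close>,
  which is the first-jump recursion summed over \<open>Y\<close> and differentiated in \<open>s\<close>. The product rule gives a discrete Green identity: the derivative of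
  \<open>\<phi>\<circ>\<tau>\<^bsub>s,x\<^esub> u\<^sub>s(x)\<close> is \<open>J\<^sub>s(x) - J\<^sub>s(x-1)\<close> with the flux \<open>J\<^sub>s(x) = f\<^sub>s(x) u\<^sub>s(x+1) - u\<^sub>s(x) f\<^sub>s(x+1)\<close>.
  Summed over a window \<open>{a..c}\<close> disjoint from \<open>Y\<close>, where \<open>u\<^sub>0\<close> vanishes, it expresses
  \<open>\<Sum> \<phi>\<circ>\<tau>\<^bsub>t,x\<^esub> u\<^sub>t(x)\<close> through the time integrals of the fluxes at \<open>c\<close> and at \<open>a-1\<close> only
  (\<open>green_identity\<close>).

  The window \<open>{-n..-1}\<close> with \<open>Y = {0..}\<close> and the window \<open>{0..n}\<close> with \<open>Y = {..<0}\<close> produce the two double sums. Each has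
  one inner boundary term, the flux at \<open>-1\<close>, and one outer boundary term at distance about \<open>n\<close> from
  \<open>Y\<close>. The inner terms combine, since the masses of the two complementary sets add up to \<open>1\<close>, to
  \<open>\<integral> (f\<^sub>s(-1) - f\<^sub>s(0)) ds = \<chi>(t,0)\<close> (\<open>flux_complementary_sum\<close>).

  The outer term tends to \<open>0\<close> in \<open>L\<^sup>1\<close> (\<open>boundary_flux_vanishes\<close>): by stationarity a spatial shift moves it back to
  the origin, where it is at most \<open>\<integral> (|f\<^sub>s(0)| v\<^sub>s(1) + |f\<^sub>s(1)| v\<^sub>s(0)) ds\<close> with \<open>v\<^sub>s\<close> the mass that the kernel
  puts at distance at least \<open>n\<close> from \<open>0\<close>. As \<open>v\<^sub>s \<le> 1\<close> tends to \<open>0\<close> and \<open>\<bbbE>|f\<^sub>s(0)| = \<bbbE>(b\<^sub>0(0) \<phi>)\<close> is finite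
  by \<open>\<phi> \<le> 1 + \<phi>\<^sup>2\<close>, dominated convergence applies. Along a
  subsequence the outer terms vanish almost surely, and since the partial sums are monotone this
  determines the limit of the full sequence and makes the double sums finite.

  That the kernel has total mass \<open>1\<close>, i.e. that the dual walk does not explode, follows from
  \<open>\<phi> = \<Sum>\<^sub>x \<phi>\<circ>\<tau>\<^bsub>t,x\<^esub> K(t,x;0,0)\<close>: taking expectations and shifting each term to the origin gives
  \<open>\<bbbE> \<phi> = \<bbbE>(\<phi>\<circ>\<tau>\<^bsub>t,0\<^esub> \<Sum>\<^sub>y K(t,0;0,y))\<close>, where the mass is at most \<open>1\<close> and \<open>\<phi> > 0\<close> (\<open>mass_conserved\<close>).
\<close>

section \<open>Primitives of Lebesgue integrable functions\<close>

lemma set_integral_singleton_eq_0: "(LBINT u:{a..a::real}. f u :: real) = 0"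
proof -
  have "AE u in lborel. indicator {a..a} u *\<^sub>R f u = 0"
    using AE_lborel_singleton[of a] by eventually_elim auto
  then show ?thesis
    unfolding set_lebesgue_integral_def by (rule integral_eq_zero_AE)
qed

text \<open>The function \<open>F\<close> is absolutely continuous on \<open>[0,T]\<close> with almost everywhere derivative \<open>f\<close>. The
  integrated form is used because the conductances are only measurable in time, so that the
  differential equations may fail at individual times.\<close>
definition has_lebesgue_derivative :: "real \<Rightarrow> (real \<Rightarrow> real) \<Rightarrow> (real \<Rightarrow> real) \<Rightarrow> bool" where
  "has_lebesgue_derivative T F f \<longleftrightarrow> set_integrable lborel {0..T} f \<and>
     (\<forall>s\<in>{0..T}. F s = F 0 + (LBINT r:{0..s}. f r))"

lemma has_lebesgue_derivativeD:
  assumes "has_lebesgue_derivative T F f"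
  shows "set_integrable lborel {0..T} f"
    and "\<And>s. 0 \<le> s \<Longrightarrow> s \<le> T \<Longrightarrow> F s = F 0 + (LBINT r:{0..s}. f r)"
    and "\<And>s. s \<le> T \<Longrightarrow> set_integrable lborel {0..s} f"
proof -
  show 1: "set_integrable lborel {0..T} f"
    and "\<And>s. 0 \<le> s \<Longrightarrow> s \<le> T \<Longrightarrow> F s = F 0 + (LBINT r:{0..s}. f r)"
    using assms unfolding has_lebesgue_derivative_def by (blast, meson atLeastAtMost_iff)
  show "set_integrable lborel {0..s} f" if "s \<le> T" for s
    by (rule set_integrable_subset[OF 1]) (use that in auto)
qed

lemma set_integrable_bounded_mult:
  fixes g h :: "real \<Rightarrow> real"
  assumes g: "set_integrable lborel A g"
    and h: "h \<in> borel_measurable borel" "\<And>r. r \<in> A \<Longrightarrow> \<bar>h r\<bar> \<le> C"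
  shows "set_integrable lborel A (\<lambda>r. h r * g r)"
  unfolding set_integrable_def
proof (rule Bochner_Integration.integrable_bound)
  show "integrable lborel (\<lambda>r. C * (indicator A r *\<^sub>R g r))"
    using g unfolding set_integrable_def by (rule integrable_mult_right)
  have "(\<lambda>r. h r * (indicator A r *\<^sub>R g r)) \<in> borel_measurable lborel"
    using g h(1) unfolding set_integrable_def by (intro borel_measurable_times) auto
  then show "(\<lambda>r. indicator A r *\<^sub>R (h r * g r)) \<in> borel_measurable lborel"
    by (simp add: mult.left_commute)
  show "AE r in lborel. norm (indicator A r *\<^sub>R (h r * g r)) \<le> norm (C * (indicator A r *\<^sub>R g r))"
  proof (intro AE_I2)
    fix r
    show "norm (indicator A r *\<^sub>R (h r * g r)) \<le> norm (C * (indicator A r *\<^sub>R g r))"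
    proof (cases "r \<in> A")
      case True
      then have "\<bar>h r\<bar> \<le> \<bar>C\<bar>" using h(2)[of r] by linarith
      then show ?thesis using True by (simp add: abs_mult mult_right_mono)
    qed simp
  qed
qed

lemma has_lebesgue_derivative_bounded:
  assumes "has_lebesgue_derivative T F f"
  obtains C where "\<And>s. s \<in> {0..T} \<Longrightarrow> \<bar>F s\<bar> \<le> C"
proof
  fix s assume s: "s \<in> {0..T}"
  note f = has_lebesgue_derivativeD[OF assms]
  have "\<bar>LBINT r:{0..s}. f r\<bar> \<le> (LBINT r:{0..s}. \<bar>f r\<bar>)"
    using integral_norm_bound[of lborel "\<lambda>r. indicator {0..s} r *\<^sub>R f r"]
    by (simp add: set_lebesgue_integral_def abs_mult)
  also have "\<dots> \<le> (LBINT r:{0..T}. \<bar>f r\<bar>)"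
    using s f(1) f(3)[of s] unfolding set_lebesgue_integral_def set_integrable_def
    by (intro integral_mono) (auto simp: indicator_def dest: integrable_abs simp: abs_mult)
  finally show "\<bar>F s\<bar> \<le> \<bar>F 0\<bar> + (LBINT r:{0..T}. \<bar>f r\<bar>)"
    using f(2)[of s] s by auto
qed

text \<open>Only the values of \<open>F\<close> on \<open>[0,T]\<close> are controlled, so its measurability comes from a globally defined
  function that agrees with it there.\<close>
lemma has_lebesgue_derivative_mult_integrable:
  assumes F: "has_lebesgue_derivative T F f" and g: "set_integrable lborel {0..T} g"
  shows "set_integrable lborel {0..T} (\<lambda>r. F r * g r)"
proof -
  define H where "H s = F 0 + (\<integral>r. indicator {0..T} r *\<^sub>R f r * indicator {0..s} r \<partial>lborel)" for s
  have [measurable]: "(\<lambda>r. indicator {0..T} r *\<^sub>R f r) \<in> borel_measurable borel"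
    using has_lebesgue_derivativeD(1)[OF F] unfolding set_integrable_def by auto
  have m: "H \<in> borel_measurable borel"
  proof -
    have [measurable]: "(\<lambda>(s::real, r::real). indicator {0..s} r :: real) \<in> borel_measurable (borel \<Otimes>\<^sub>M borel)"
      unfolding indicator_def atLeastAtMost_iff by measurable
    show ?thesis unfolding H_def by measurable
  qed
  have eq: "H s = F s" if "s \<in> {0..T}" for s
    using has_lebesgue_derivativeD(2)[OF F, of s] that unfolding H_def set_lebesgue_integral_def
    by (auto intro!: Bochner_Integration.integral_cong simp: indicator_def)
  obtain C where "\<And>s. s \<in> {0..T} \<Longrightarrow> \<bar>F s\<bar> \<le> C" using has_lebesgue_derivative_bounded[OF F] by blast
  then have "set_integrable lborel {0..T} (\<lambda>r. H r * g r)"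
    using eq by (intro set_integrable_bounded_mult[OF g m]) auto
  moreover have "set_integrable lborel {0..T} (\<lambda>r. H r * g r) = set_integrable lborel {0..T} (\<lambda>r. F r * g r)"
    using eq by (intro set_integrable_cong) auto
  ultimately show ?thesis by simp
qed

text \<open>The integral of \<open>f(r) g(q)\<close> over the square \<open>[0,s]\<^sup>2\<close> is \<open>(F s - F 0) (G s - G 0)\<close>. Cutting the square along
  its diagonal and integrating out one variable in each triangle gives the two terms of the product
  rule.\<close>
lemma has_lebesgue_derivative_mult:
  assumes F: "has_lebesgue_derivative T F f" and G: "has_lebesgue_derivative T G g"
  shows "has_lebesgue_derivative T (\<lambda>s. F s * G s) (\<lambda>s. G s * f s + F s * g s)"
  unfolding has_lebesgue_derivative_def
proof (intro conjI ballI)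
  have Gf: "set_integrable lborel {0..T} (\<lambda>r. G r * f r)"
    and Fg: "set_integrable lborel {0..T} (\<lambda>r. F r * g r)"
    using has_lebesgue_derivative_mult_integrable[OF G has_lebesgue_derivativeD(1)[OF F]]
      has_lebesgue_derivative_mult_integrable[OF F has_lebesgue_derivativeD(1)[OF G]] by auto
  then show "set_integrable lborel {0..T} (\<lambda>s. G s * f s + F s * g s)"
    by (rule set_integral_add(1))
  fix s assume s: "s \<in> {0..T}"
  define f' g' where "f' = (\<lambda>r. indicator {0..s} r * f r)" and "g' = (\<lambda>r. indicator {0..s} r * g r)"
  have f': "integrable lborel f'" and g': "integrable lborel g'"
    using has_lebesgue_derivativeD(3)[OF F, of s] has_lebesgue_derivativeD(3)[OF G, of s] s
    by (auto simp: set_integrable_def f'_def g'_def)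
  then have [measurable]: "f' \<in> borel_measurable borel" "g' \<in> borel_measurable borel" by auto
  have fg: "integrable (lborel \<Otimes>\<^sub>M lborel) (\<lambda>(r, q). f' r * g' q)"
    by (rule lborel_pair.Fubini_integrable) (use f' g' in \<open>auto simp: abs_mult\<close>)
  \<comment> \<open>The strict inequality in the second triangle keeps the two triangles disjoint.\<close>
  have fg1: "integrable (lborel \<Otimes>\<^sub>M lborel) (\<lambda>(r, q). f' r * (if q \<le> r then g' q else 0))"
    by (rule Bochner_Integration.integrable_bound[OF fg]) auto
  have fg2: "integrable (lborel \<Otimes>\<^sub>M lborel) (\<lambda>(r, q). g' q * (if r < q then f' r else 0))"
    by (rule Bochner_Integration.integrable_bound[OF fg]) (auto simp: abs_mult mult.commute)
  have I1: "(\<integral>q. (if q \<le> r then g' q else 0) \<partial>lborel) = G r - G 0" if "r \<in> {0..s}" for r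
  proof -
    have "(\<integral>q. (if q \<le> r then g' q else 0) \<partial>lborel) = (LBINT q:{0..r}. g q)"
      unfolding set_lebesgue_integral_def g'_def using that
      by (intro Bochner_Integration.integral_cong) (auto simp: indicator_def)
    then show ?thesis using has_lebesgue_derivativeD(2)[OF G, of r] that s by auto
  qed
  have I2: "(\<integral>r. (if r < q then f' r else 0) \<partial>lborel) = F q - F 0" if "q \<in> {0..s}" for q
  proof -
    have "(\<integral>r. (if r < q then f' r else 0) \<partial>lborel) = (\<integral>r. (if r \<le> q then f' r else 0) \<partial>lborel)"
      using AE_lborel_singleton[of q] by (intro integral_cong_AE) auto
    also have "\<dots> = (LBINT r:{0..q}. f r)"
      unfolding set_lebesgue_integral_def f'_def using that
      by (intro Bochner_Integration.integral_cong) (auto simp: indicator_def)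
    finally show ?thesis using has_lebesgue_derivativeD(2)[OF F, of q] that s by auto
  qed
  have "(\<integral>r. f' r \<partial>lborel) * (\<integral>q. g' q \<partial>lborel) = (\<integral>r. (\<integral>q. f' r * g' q \<partial>lborel) \<partial>lborel)"
    using f' g' by simp
  also have "\<dots> = (\<integral>p. (case p of (r, q) \<Rightarrow> f' r * g' q) \<partial>(lborel \<Otimes>\<^sub>M lborel))"
    using lborel_pair.integral_fst'[OF fg] by simp
  also have "\<dots> = (\<integral>p. (case p of (r, q) \<Rightarrow> f' r * (if q \<le> r then g' q else 0))
      + (case p of (r, q) \<Rightarrow> g' q * (if r < q then f' r else 0)) \<partial>(lborel \<Otimes>\<^sub>M lborel))"
    by (intro Bochner_Integration.integral_cong) auto
  also have "\<dots> = (\<integral>r. (\<integral>q. f' r * (if q \<le> r then g' q else 0) \<partial>lborel) \<partial>lborel)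
      + (\<integral>q. (\<integral>r. g' q * (if r < q then f' r else 0) \<partial>lborel) \<partial>lborel)"
    using Bochner_Integration.integral_add[OF fg1 fg2] lborel_pair.integral_fst'[OF fg1]
      lborel_pair.integral_snd[OF fg2] by simp
  also have "(\<integral>r. (\<integral>q. f' r * (if q \<le> r then g' q else 0) \<partial>lborel) \<partial>lborel)
      = (\<integral>r. f' r * (G r - G 0) \<partial>lborel)"
    using I1 by (intro Bochner_Integration.integral_cong) (auto simp: f'_def indicator_def)
  also have "(\<integral>q. (\<integral>r. g' q * (if r < q then f' r else 0) \<partial>lborel) \<partial>lborel)
      = (\<integral>q. g' q * (F q - F 0) \<partial>lborel)"
    using I2 by (intro Bochner_Integration.integral_cong) (auto simp: g'_def indicator_def)
  also have "(\<integral>r. f' r * (G r - G 0) \<partial>lborel) = (LBINT r:{0..s}. G r * f r) - G 0 * (\<integral>r. f' r \<partial>lborel)"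
  proof -
    have "integrable lborel (\<lambda>r. indicator {0..s} r * (G r * f r))"
      using set_integrable_subset[OF Gf, of "{0..s}"] s by (auto simp: set_integrable_def)
    then show ?thesis using f' by (simp add: set_lebesgue_integral_def f'_def algebra_simps)
  qed
  also have "(\<integral>r. g' r * (F r - F 0) \<partial>lborel) = (LBINT r:{0..s}. F r * g r) - F 0 * (\<integral>r. g' r \<partial>lborel)"
  proof -
    have "integrable lborel (\<lambda>r. indicator {0..s} r * (F r * g r))"
      using set_integrable_subset[OF Fg, of "{0..s}"] s by (auto simp: set_integrable_def)
    then show ?thesis using g' by (simp add: set_lebesgue_integral_def g'_def algebra_simps)
  qed
  finally have main: "(\<integral>r. f' r \<partial>lborel) * (\<integral>q. g' q \<partial>lborel) =
     (LBINT r:{0..s}. G r * f r) - G 0 * (\<integral>r. f' r \<partial>lborel) +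
     ((LBINT r:{0..s}. F r * g r) - F 0 * (\<integral>r. g' r \<partial>lborel))" .
  have "(\<integral>r. f' r \<partial>lborel) = F s - F 0" "(\<integral>q. g' q \<partial>lborel) = G s - G 0"
    using has_lebesgue_derivativeD(2)[OF F, of s] has_lebesgue_derivativeD(2)[OF G, of s] s
    by (auto simp: set_lebesgue_integral_def f'_def g'_def)
  note main[unfolded this]
  moreover have "(LBINT r:{0..s}. G r * f r + F r * g r) =
      (LBINT r:{0..s}. G r * f r) + (LBINT r:{0..s}. F r * g r)"
    by (intro set_integral_add(2) set_integrable_subset[OF Gf] set_integrable_subset[OF Fg])
      (use s in auto)
  ultimately show "F s * G s = F 0 * G 0 + (LBINT r:{0..s}. G r * f r + F r * g r)"
    by (simp add: algebra_simps)
qed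

lemma has_lebesgue_derivative_const: "has_lebesgue_derivative T (\<lambda>s. c) (\<lambda>s. 0)"
  by (simp add: has_lebesgue_derivative_def set_lebesgue_integral_def set_integrable_def)

lemma has_lebesgue_derivative_add:
  assumes F: "has_lebesgue_derivative T F f" and G: "has_lebesgue_derivative T G g"
  shows "has_lebesgue_derivative T (\<lambda>s. F s + G s) (\<lambda>s. f s + g s)"
  unfolding has_lebesgue_derivative_def
proof (intro conjI ballI)
  show "set_integrable lborel {0..T} (\<lambda>s. f s + g s)"
    by (rule set_integral_add(1)[OF has_lebesgue_derivativeD(1)[OF F] has_lebesgue_derivativeD(1)[OF G]])
  fix s assume "s \<in> {0..T}"
  then show "F s + G s = F 0 + G 0 + (LBINT r:{0..s}. f r + g r)"
    using has_lebesgue_derivativeD(2)[OF F, of s] has_lebesgue_derivativeD(2)[OF G, of s]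
      set_integral_add(2)[OF has_lebesgue_derivativeD(3)[OF F, of s] has_lebesgue_derivativeD(3)[OF G, of s]] by auto
qed

lemma has_lebesgue_derivative_sum:
  assumes "\<And>x. x \<in> X \<Longrightarrow> has_lebesgue_derivative T (F x) (f x)"
  shows "has_lebesgue_derivative T (\<lambda>s. \<Sum>x\<in>X. F x s) (\<lambda>s. \<Sum>x\<in>X. f x s)"
  using assms
  by (induction X rule: infinite_finite_induct)
    (auto intro: has_lebesgue_derivative_add simp: has_lebesgue_derivative_const)

lemma has_lebesgue_derivative_power:
  assumes F: "has_lebesgue_derivative T F f"
  shows "has_lebesgue_derivative T (\<lambda>s. F s ^ Suc k) (\<lambda>s. of_nat (Suc k) * F s ^ k * f s)"
proof (induction k)
  case 0 then show ?case using F by simp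
next
  case (Suc k)
  have "has_lebesgue_derivative T (\<lambda>s. F s ^ Suc k * F s)
      (\<lambda>s. F s * (of_nat (Suc k) * F s ^ k * f s) + F s ^ Suc k * f s)"
    by (rule has_lebesgue_derivative_mult[OF Suc F])
  then show ?case by (simp add: algebra_simps)
qed

lemma has_lebesgue_derivative_cmult:
  "has_lebesgue_derivative T F f \<Longrightarrow> has_lebesgue_derivative T (\<lambda>s. c * F s) (\<lambda>s. c * f s)"
  using has_lebesgue_derivative_mult[OF has_lebesgue_derivative_const[of T c]] by force

text \<open>The product rule yields the chain rule for the Taylor polynomials of the exponential; since \<open>F\<close> is
  bounded on \<open>[0,T]\<close>, dominated convergence passes to the full series.\<close>
lemma has_lebesgue_derivative_exp:
  assumes F: "has_lebesgue_derivative T F f"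
  shows "has_lebesgue_derivative T (\<lambda>s. exp (F s)) (\<lambda>s. exp (F s) * f s)"
proof -
  obtain C where C: "\<And>s. s \<in> {0..T} \<Longrightarrow> \<bar>F s\<bar> \<le> C" using has_lebesgue_derivative_bounded[OF F] by blast
  have pw: "has_lebesgue_derivative T (\<lambda>s. F s ^ Suc k / fact (Suc k)) (\<lambda>s. F s ^ k / fact k * f s)" for k
    using has_lebesgue_derivative_cmult[OF has_lebesgue_derivative_power[OF F], of "1 / fact (Suc k)" k]
    by (simp add: field_simps del: of_nat_Suc power_Suc)
  \<comment> \<open>The Taylor polynomial without its constant term has the Taylor polynomial of one degree less as derivative.\<close>
  have part: "has_lebesgue_derivative T (\<lambda>s. \<Sum>k<n. F s ^ Suc k / fact (Suc k)) (\<lambda>s. (\<Sum>k<n. F s ^ k / fact k) * f s)" for n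
    using has_lebesgue_derivative_sum[where X = "{..<n}", OF pw] by (simp add: sum_distrib_right)
  have lim0: "(\<lambda>n. \<Sum>k<n. x ^ k / fact k) \<longlonglongrightarrow> exp (x::real)" for x
    using exp_converges[of x] by (simp add: sums_def divide_inverse mult.commute)
  have lim1: "(\<lambda>n. \<Sum>k<n. x ^ Suc k / fact (Suc k)) \<longlonglongrightarrow> exp (x::real) - 1" for x
  proof -
    have "(\<lambda>n. (\<Sum>k<Suc n. x ^ k / fact k) - 1) \<longlonglongrightarrow> exp x - 1"
      by (intro tendsto_diff LIMSEQ_Suc[OF lim0] tendsto_const)
    then show ?thesis by (simp add: sum.lessThan_Suc_shift del: sum.lessThan_Suc fact_Suc)
  qed
  have bnd: "\<bar>\<Sum>k<n. x ^ k / fact k\<bar> \<le> exp \<bar>x\<bar>" for x :: real and n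
  proof -
    have "\<bar>\<Sum>k<n. x ^ k / fact k\<bar> \<le> (\<Sum>k<n. \<bar>x\<bar> ^ k / fact k)"
      by (rule order_trans[OF sum_abs]) (simp add: power_abs)
    also have "\<dots> \<le> exp \<bar>x\<bar>"
      by (rule incseq_le[OF _ lim0]) (intro incseq_SucI, simp)
    finally show ?thesis .
  qed
  have conv: "set_integrable lborel {0..s} (\<lambda>r. exp (F r) * f r) \<and>
      (\<lambda>n. LBINT r:{0..s}. (\<Sum>k<n. F r ^ k / fact k) * f r) \<longlonglongrightarrow> (LBINT r:{0..s}. exp (F r) * f r)"
    if s: "s \<le> T" for s
  proof -
    let ?u = "\<lambda>n r. indicator {0..s} r *\<^sub>R ((\<Sum>k<n. F r ^ k / fact k) * f r)"
    have i: "integrable lborel (?u n)" for n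
      using has_lebesgue_derivativeD(3)[OF part, of s n] s by (simp add: set_integrable_def)
    have lim: "AE r in lborel. (\<lambda>n. ?u n r) \<longlonglongrightarrow> indicator {0..s} r *\<^sub>R (exp (F r) * f r)"
      by (intro AE_I2 tendsto_intros lim0)
    have m: "(\<lambda>r. indicator {0..s} r *\<^sub>R (exp (F r) * f r)) \<in> borel_measurable lborel"
      by (rule borel_measurable_LIMSEQ_real[of lborel ?u])
         (use i lim0 in \<open>auto intro!: tendsto_intros\<close>)
    have d: "integrable lborel (\<lambda>r. exp C * (indicator {0..s} r *\<^sub>R \<bar>f r\<bar>))"
      using has_lebesgue_derivativeD(3)[OF F s] integrable_abs[of lborel "\<lambda>r. indicator {0..s} r *\<^sub>R f r"]
      by (auto simp: set_integrable_def abs_mult)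
    have le: "AE r in lborel. norm (?u n r) \<le> exp C * (indicator {0..s} r *\<^sub>R \<bar>f r\<bar>)" for n
      using C s by (intro AE_I2)
        (auto simp: indicator_def abs_mult intro!: mult_right_mono intro: order_trans[OF bnd])
    show ?thesis
      using integral_dominated_convergence[OF m _ d lim le] integrable_dominated_convergence[OF m _ d lim le] i
      by (auto simp: set_integrable_def set_lebesgue_integral_def)
  qed
  show ?thesis
    unfolding has_lebesgue_derivative_def
  proof (intro conjI ballI)
    show "set_integrable lborel {0..T} (\<lambda>s. exp (F s) * f s)" using conv[of T] by simp
    fix s assume s: "s \<in> {0..T}"
    have "(\<lambda>n. (\<Sum>k<n. F s ^ Suc k / fact (Suc k)) - (\<Sum>k<n. F 0 ^ Suc k / fact (Suc k)))
        \<longlonglongrightarrow> (exp (F s) - 1) - (exp (F 0) - 1)"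
      by (intro tendsto_diff lim1)
    then have "(\<lambda>n. LBINT r:{0..s}. (\<Sum>k<n. F r ^ k / fact k) * f r) \<longlonglongrightarrow> (exp (F s) - 1) - (exp (F 0) - 1)"
      using has_lebesgue_derivativeD(2)[OF part, of s] s by simp
    with conv[of s] s have "(exp (F s) - 1) - (exp (F 0) - 1) = (LBINT r:{0..s}. exp (F r) * f r)"
      by (auto intro: LIMSEQ_unique)
    then show "exp (F s) = exp (F 0) + (LBINT r:{0..s}. exp (F r) * f r)" by simp
  qed
qed

lemma has_lebesgue_derivative_cong:
  assumes "has_lebesgue_derivative T F f" and "\<And>s. 0 \<le> s \<Longrightarrow> s \<le> T \<Longrightarrow> F s = G s"
    and "\<And>s. 0 \<le> s \<Longrightarrow> s \<le> T \<Longrightarrow> f s = g s"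
  shows "has_lebesgue_derivative T G g"
proof -
  have "set_integrable lborel {0..T} f = set_integrable lborel {0..T} g"
    by (intro set_integrable_cong) (use assms(3) in auto)
  moreover have "(LBINT r:{0..s}. f r) = (LBINT r:{0..s}. g r)" if "s \<le> T" for s
    by (intro set_lebesgue_integral_cong) (use assms(3) that in auto)
  moreover have "G s = G 0 + (LBINT r:{0..s}. f r)" if "0 \<le> s" "s \<le> T" for s
    using has_lebesgue_derivativeD(2)[OF assms(1) that] assms(2)[of s] assms(2)[of 0] that by simp
  ultimately show ?thesis
    using has_lebesgue_derivativeD(1)[OF assms(1)] unfolding has_lebesgue_derivative_def by (metis atLeastAtMost_iff)
qed

section \<open>Sums over the integers\<close>

lemma window_sums_tendsto_infsum:
  fixes f :: "int \<Rightarrow> real"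
  assumes "f summable_on Y"
  shows "(\<lambda>k. sum f (Y \<inter> {- int k..int k})) \<longlonglongrightarrow> infsum f Y"
proof -
  have "filterlim (\<lambda>k. Y \<inter> {- int k..int k}) (finite_subsets_at_top Y) sequentially"
    unfolding filterlim_finite_subsets_at_top
  proof (intro allI impI)
    fix X assume X: "finite X \<and> X \<subseteq> Y"
    show "eventually (\<lambda>k. finite (Y \<inter> {- int k..int k}) \<and> X \<subseteq> Y \<inter> {- int k..int k} \<and> Y \<inter> {- int k..int k} \<subseteq> Y) sequentially"
    proof (rule eventually_sequentiallyI[of "nat (\<Sum>x\<in>X. \<bar>x\<bar>)"], intro conjI)
      fix k assume k: "k \<ge> nat (\<Sum>x\<in>X. \<bar>x\<bar>)"
      have "\<bar>x\<bar> \<le> int k" if "x \<in> X" for x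
        using member_le_sum[of x X abs] that X k by auto
      then show "X \<subseteq> Y \<inter> {- int k..int k}" using X by (force simp: abs_le_iff)
    qed auto
  qed
  moreover have "(sum f \<longlongrightarrow> infsum f Y) (finite_subsets_at_top Y)"
    using has_sum_infsum[OF assms] by (simp add: has_sum_def)
  ultimately show ?thesis by (rule filterlim_compose[rotated])
qed

lemma sum_telescope_int:
  fixes q :: "int \<Rightarrow> real"
  assumes "a \<le> c + 1"
  shows "(\<Sum>x\<in>{a..c}. q x - q (x - 1)) = q c - q (a - 1)"
proof -
  have "(\<Sum>x\<in>{a..k - 1}. q x - q (x - 1)) = q (k - 1) - q (a - 1)" if "a \<le> k" for k
    using that
  proof (induction k rule: int_ge_induct)
    case (step i)
    then have "{a..i + 1 - 1} = insert i {a..i - 1}" by auto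
    then show ?case using step by simp
  qed simp
  from this[of "c + 1"] show ?thesis using assms by simp
qed

text \<open>For nonnegative terms the sums over growing windows increase, so that their convergence along a
  subsequence already bounds all finite sums and identifies the limit.\<close>
lemma has_sum_of_window_subsequence:
  fixes h :: "int \<Rightarrow> real"
  assumes nonneg: "\<And>x. x \<in> X \<Longrightarrow> 0 \<le> h x" and r: "strict_mono r"
    and lim: "(\<lambda>n. sum h (X \<inter> {- int (r n)..int (r n)})) \<longlonglongrightarrow> L"
  shows "(h has_sum L) X"
proof -
  have inc: "incseq (\<lambda>n. sum h (X \<inter> {- int (r n)..int (r n)}))"
  proof (rule incseq_SucI, rule sum_mono2)
    fix n
    have "int (r n) \<le> int (r (Suc n))" using strict_monoD[OF r, of n "Suc n"] by simp
    then show "X \<inter> {- int (r n)..int (r n)} \<subseteq> X \<inter> {- int (r (Suc n))..int (r (Suc n))}" by auto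
  qed (use nonneg in auto)
  have "sum h F \<le> L" if F: "F \<subseteq> X" "finite F" for F
  proof -
    let ?n = "nat (\<Sum>x\<in>F. \<bar>x\<bar>)"
    have "\<bar>x\<bar> \<le> int (r ?n)" if "x \<in> F" for x
      using member_le_sum[of x F abs] that F seq_suble[OF r, of ?n] by simp
    then have "sum h F \<le> sum h (X \<inter> {- int (r ?n)..int (r ?n)})"
      using F nonneg by (intro sum_mono2) (force simp: abs_le_iff)+
    also have "\<dots> \<le> L" by (rule incseq_le[OF inc lim])
    finally show ?thesis .
  qed
  then have S: "h summable_on X"
    by (intro nonneg_bdd_above_summable_on nonneg bdd_aboveI[where M = L]) auto
  have "(\<lambda>n. sum h (X \<inter> {- int (r n)..int (r n)})) \<longlonglongrightarrow> infsum h X"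
    using LIMSEQ_subseq_LIMSEQ[OF window_sums_tendsto_infsum[OF S] r] by (simp add: o_def)
  then have "infsum h X = L" using lim by (rule LIMSEQ_unique)
  then show ?thesis using has_sum_infsum[OF S] by simp
qed

section \<open>The first-jump recursion in a fixed environment\<close>

text \<open>The property that makes the integrals of the first-jump recursion converge and that the recursion
  preserves.\<close>
definition unit_valued :: "(real \<Rightarrow> int \<Rightarrow> real) \<Rightarrow> bool" where
  "unit_valued g \<longleftrightarrow> (\<forall>x. (\<lambda>r. g r x) \<in> borel_measurable borel) \<and> (\<forall>r x. 0 \<le> g r x \<and> g r x \<le> 1)"

lemma unit_valuedD:
  assumes "unit_valued g"
  shows "(\<lambda>r. g r x) \<in> borel_measurable borel" "0 \<le> g r x" "g r x \<le> 1"
  using assms by (auto simp: unit_valued_def)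

context dynamical_conductances
begin

text \<open>The walk leaves \<open>x\<close> at rate \<open>2 b\<^sub>u(x)\<close>, so \<open>exp (- total_rate \<omega> x s)\<close> is the probability that it does not
  jump when it is run backward from time \<open>s\<close> to time \<open>0\<close> at \<open>x\<close>.\<close>
definition total_rate :: "'a \<Rightarrow> int \<Rightarrow> real \<Rightarrow> real" where
  "total_rate \<omega> x s = (LBINT u:{0..s}. 2 * b u x \<omega>)"

text \<open>The right-hand side of the recursion for \<open>K\<close>, with lower time \<open>0\<close>, initial datum \<open>c\<close> in place of the Kronecker
  delta and \<open>g\<close> in place of the previous iterate. The factor \<open>exp (- total_rate \<omega> x s)\<close> is pulled out of the
  integral so that the remaining integrand does not depend on \<open>s\<close>.\<close>
definition first_jump ::
    "'a \<Rightarrow> (int \<Rightarrow> real) \<Rightarrow> (real \<Rightarrow> int \<Rightarrow> real) \<Rightarrow> real \<Rightarrow> int \<Rightarrow> real" where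
  "first_jump \<omega> c g s x = exp (- total_rate \<omega> x s) *
     (c x + (LBINT r:{0..s}. exp (total_rate \<omega> x r) * b r x \<omega> * (g r (x + 1) + g r (x - 1))))"

text \<open>As a function of \<open>(s, x)\<close> this solves the first-jump recursion and the backward equation with initial datum the indicator of
  \<open>Y\<close>.\<close>
definition dual_mass :: "'a \<Rightarrow> int set \<Rightarrow> real \<Rightarrow> int \<Rightarrow> real" where
  "dual_mass \<omega> Y s x = (\<Sum>\<^sub>\<infinity>y\<in>Y. dual_kernel b \<omega> s x 0 y)"

lemma conductance_measurable_compose [measurable (raw)]:
  "f \<in> borel_measurable N \<Longrightarrow> g \<in> measurable N M \<Longrightarrow> (\<lambda>q. b (f q) x (g q)) \<in> borel_measurable N"
  using measurable_compose[OF measurable_Pair conductance_measurable[of x], of f N g] by simp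

lemma kernel_approx_measurable:
  "(\<lambda>p. dual_kernel_approx b (snd p) n (fst p) x 0 y) \<in> borel_measurable (borel \<Otimes>\<^sub>M M)"
proof (induction n arbitrary: x)
  case (Suc n)
  have IH: "(\<lambda>q. dual_kernel_approx b (snd (fst q)) n (snd q) z 0 y)
      \<in> borel_measurable ((borel \<Otimes>\<^sub>M M) \<Otimes>\<^sub>M borel)" for z
  proof -
    have "(\<lambda>q. (snd q, snd (fst q))) \<in> measurable ((borel \<Otimes>\<^sub>M M) \<Otimes>\<^sub>M borel) (borel \<Otimes>\<^sub>M M)"
      by measurable
    from measurable_compose[OF this Suc[of z]] show ?thesis by simp
  qed
  have [measurable]: "(\<lambda>(p, r). LBINT u:{r..fst p}. 2 * b u x (snd p))
      \<in> borel_measurable ((borel \<Otimes>\<^sub>M M) \<Otimes>\<^sub>M borel)"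
    unfolding set_lebesgue_integral_def indicator_def atLeastAtMost_iff by measurable
  have [measurable]: "(\<lambda>p. LBINT u:{0..fst p}. 2 * b u x (snd p)) \<in> borel_measurable (borel \<Otimes>\<^sub>M M)"
    unfolding set_lebesgue_integral_def indicator_def atLeastAtMost_iff by measurable
  have [measurable]: "(\<lambda>(p, r). \<Sum>z\<in>{1, -1}. dual_kernel_approx b (snd p) n r (x + z) 0 y)
      \<in> borel_measurable ((borel \<Otimes>\<^sub>M M) \<Otimes>\<^sub>M borel)"
    unfolding split_beta by (intro borel_measurable_sum IH)
  have [measurable]: "(\<lambda>p. LBINT r:{0..fst p}. exp (- (LBINT u:{r..fst p}. 2 * b u x (snd p))) * b r x (snd p) *
        (\<Sum>z\<in>{1, -1}. dual_kernel_approx b (snd p) n r (x + z) 0 y)) \<in> borel_measurable (borel \<Otimes>\<^sub>M M)"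
    unfolding set_lebesgue_integral_def[of lborel "{0.._}"] indicator_def atLeastAtMost_iff by measurable
  show ?case unfolding dual_kernel_approx.simps by measurable
qed simp

lemma dual_kernel_measurable:
  "(\<lambda>p. dual_kernel b (snd p) (fst p) x 0 y) \<in> borel_measurable (borel \<Otimes>\<^sub>M M)"
  unfolding dual_kernel_def by (intro borel_measurable_lim_metric kernel_approx_measurable)

text \<open>Every iterate inherits the covariance of the conductances under spatial shifts.\<close>
lemma kernel_shift:
  assumes "\<omega> \<in> space M"
  shows "dual_kernel b (\<tau> 0 z \<omega>) s x 0 y = dual_kernel b \<omega> s (x + z) 0 (y + z)"
proof -
  have "dual_kernel_approx b (\<tau> 0 z \<omega>) n s x 0 y = dual_kernel_approx b \<omega> n s (x + z) 0 (y + z)" for n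
    by (induction n arbitrary: s x) (simp_all add: conductance_shift[OF assms] algebra_simps)
  then show ?thesis by (simp add: dual_kernel_def)
qed

context
  fixes \<omega> assumes \<omega>: "\<omega> \<in> space M"
begin

lemma total_rate_0: "s \<le> 0 \<Longrightarrow> total_rate \<omega> x s = 0"
  using set_integral_singleton_eq_0[of 0] by (cases "s = 0") (auto simp: total_rate_def set_lebesgue_integral_def)

lemma total_rate_derivative: "has_lebesgue_derivative T (total_rate \<omega> x) (\<lambda>u. 2 * b u x \<omega>)"
  using conductance_locally_integrable[OF \<omega>] total_rate_0[of 0]
  by (auto simp: has_lebesgue_derivative_def total_rate_def)

lemma total_rate_split:
  assumes "0 \<le> r" "r \<le> s"
  shows "(LBINT u:{r..s}. 2 * b u x \<omega>) = total_rate \<omega> x s - total_rate \<omega> x r"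
proof -
  have i: "set_integrable lborel {a..c} (\<lambda>u. 2 * b u x \<omega>)" for a c
    using conductance_locally_integrable[OF \<omega>] by simp
  have bm: "(\<lambda>u. b u x \<omega>) \<in> borel_measurable borel" using \<omega> by measurable
  have "total_rate \<omega> x s = (\<integral>u. indicator {0..r} u *\<^sub>R (2 * b u x \<omega>) + indicator {r..s} u *\<^sub>R (2 * b u x \<omega>) \<partial>lborel)"
    unfolding total_rate_def set_lebesgue_integral_def
  proof (rule integral_cong_AE)
    show "AE u in lborel. indicator {0..s} u *\<^sub>R (2 * b u x \<omega>) =
        indicator {0..r} u *\<^sub>R (2 * b u x \<omega>) + indicator {r..s} u *\<^sub>R (2 * b u x \<omega>)"
      using AE_lborel_singleton[of r] by eventually_elim (use assms in \<open>auto simp: indicator_def\<close>)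
  qed (use bm in measurable)
  also have "\<dots> = total_rate \<omega> x r + (LBINT u:{r..s}. 2 * b u x \<omega>)"
    unfolding total_rate_def set_lebesgue_integral_def
    by (rule Bochner_Integration.integral_add[OF i[unfolded set_integrable_def] i[unfolded set_integrable_def]])
  finally show ?thesis by simp
qed

text \<open>The rate accumulated over \<open>[r,s]\<close> is a difference of total rates, which separates the variables \<open>r\<close> and
  \<open>s\<close> in the exponential.\<close>
lemma kernel_approx_Suc:
  "dual_kernel_approx b \<omega> (Suc n) s x 0 y =
     first_jump \<omega> (\<lambda>x. of_bool (x = y)) (\<lambda>r x. dual_kernel_approx b \<omega> n r x 0 y) s x"
proof -
  let ?S = "\<lambda>r. dual_kernel_approx b \<omega> n r (x + 1) 0 y + dual_kernel_approx b \<omega> n r (x - 1) 0 y"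
  have "(LBINT r:{0..s}. exp (- (LBINT u:{r..s}. 2 * b u x \<omega>)) * b r x \<omega> * ?S r) =
      (LBINT r:{0..s}. exp (- total_rate \<omega> x s) * (exp (total_rate \<omega> x r) * b r x \<omega> * ?S r))"
  proof (intro set_lebesgue_integral_cong allI impI)
    fix r assume "r \<in> {0..s}"
    then have "exp (- (LBINT u:{r..s}. 2 * b u x \<omega>)) = exp (- total_rate \<omega> x s) * exp (total_rate \<omega> x r)"
      by (simp only: total_rate_split atLeastAtMost_iff exp_add[symmetric]) simp
    then show "exp (- (LBINT u:{r..s}. 2 * b u x \<omega>)) * b r x \<omega> * ?S r =
        exp (- total_rate \<omega> x s) * (exp (total_rate \<omega> x r) * b r x \<omega> * ?S r)"
      by (simp only: mult.assoc)
  qed simp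
  also have "\<dots> = exp (- total_rate \<omega> x s) * (LBINT r:{0..s}. exp (total_rate \<omega> x r) * b r x \<omega> * ?S r)"
    by (rule set_integral_mult_right)
  finally have I: "(LBINT r:{0..s}. exp (- (LBINT u:{r..s}. 2 * b u x \<omega>)) * b r x \<omega> * ?S r) = \<dots>" .
  have S: "(\<Sum>z\<in>{1, -1}. dual_kernel_approx b \<omega> n r (x + z) 0 y) = ?S r" for r
    by simp
  show ?thesis
    unfolding dual_kernel_approx.simps first_jump_def S I
    by (simp only: total_rate_def[symmetric] of_bool_def distrib_left[symmetric])
qed

lemma first_jump_integrand_integrable:
  assumes "unit_valued g"
  shows "set_integrable lborel {0..s} (\<lambda>r. exp (total_rate \<omega> x r) * b r x \<omega> * (g r (x + 1) + g r (x - 1)))"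
proof -
  have 1: "set_integrable lborel {0..s} (\<lambda>r. exp (total_rate \<omega> x r) * b r x \<omega>)"
    using has_lebesgue_derivative_mult_integrable[OF has_lebesgue_derivative_exp[OF total_rate_derivative]
      conductance_locally_integrable[OF \<omega>, of 0 s]] .
  have "set_integrable lborel {0..s} (\<lambda>r. (g r (x + 1) + g r (x - 1)) * (exp (total_rate \<omega> x r) * b r x \<omega>))"
  proof (rule set_integrable_bounded_mult[OF 1, where C = 2])
    show "(\<lambda>r. g r (x + 1) + g r (x - 1)) \<in> borel_measurable borel"
      using unit_valuedD(1)[OF assms] by measurable
    show "\<bar>g r (x + 1) + g r (x - 1)\<bar> \<le> 2" for r
      using unit_valuedD(2,3)[OF assms, of r "x + 1"] unit_valuedD(2,3)[OF assms, of r "x - 1"] by simp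
  qed
  then show ?thesis by (simp add: mult.commute)
qed

text \<open>Integrated form of \<open>(e\<^sup>B)' = e\<^sup>B B'\<close>; it says that the constant \<open>1\<close> is a fixed point of the recursion.\<close>
lemma exp_total_rate_eq:
  "exp (total_rate \<omega> x s) = 1 + (LBINT r:{0..s}. exp (total_rate \<omega> x r) * b r x \<omega> * 2)"
proof (cases "0 \<le> s")
  case True
  then show ?thesis
    using has_lebesgue_derivativeD(2)[OF has_lebesgue_derivative_exp[OF total_rate_derivative], of s s x] total_rate_0[of 0]
    by (simp add: algebra_simps)
qed (simp add: total_rate_0 set_lebesgue_integral_def)

lemma first_jump_one: "first_jump \<omega> (\<lambda>_. 1) (\<lambda>_ _. 1) s x = 1"
  unfolding first_jump_def one_add_one exp_total_rate_eq[symmetric] by (simp add: exp_minus)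

lemma first_jump_mono:
  assumes "unit_valued g" "unit_valued h" and "c x \<le> d x" and "\<And>r x. g r x \<le> h r x"
  shows "first_jump \<omega> c g s x \<le> first_jump \<omega> d h s x"
  unfolding first_jump_def
  using assms conductance_pos[OF \<omega>]
  by (intro mult_left_mono add_mono set_integral_mono first_jump_integrand_integrable)
    (auto intro!: mult_left_mono add_mono less_imp_le)

lemma first_jump_sum:
  assumes "\<And>y. y \<in> Y \<Longrightarrow> unit_valued (g y)"
  shows "(\<Sum>y\<in>Y. first_jump \<omega> (c y) (g y) s x) =
    first_jump \<omega> (\<lambda>x. \<Sum>y\<in>Y. c y x) (\<lambda>r x. \<Sum>y\<in>Y. g y r x) s x"
proof -
  let ?I = "\<lambda>y r. exp (total_rate \<omega> x r) * b r x \<omega> * (g y r (x + 1) + g y r (x - 1))"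
  have "(\<Sum>y\<in>Y. LBINT r:{0..s}. ?I y r) = (LBINT r:{0..s}. (\<Sum>y\<in>Y. ?I y r))"
    unfolding set_lebesgue_integral_def scaleR_sum_right
    using first_jump_integrand_integrable[OF assms, unfolded set_integrable_def]
    by (rule Bochner_Integration.integral_sum[symmetric])
  then show ?thesis
    unfolding first_jump_def by (simp add: sum_distrib_left[symmetric] sum.distrib)
qed

lemma first_jump_limit:
  assumes g: "\<And>n. unit_valued (g n)" and lim: "\<And>r x. (\<lambda>n. g n r x) \<longlonglongrightarrow> h r x"
    and c: "(\<lambda>n. c n x) \<longlonglongrightarrow> d x"
  shows "(\<lambda>n. first_jump \<omega> (c n) (g n) s x) \<longlonglongrightarrow> first_jump \<omega> d h s x"
proof -
  let ?I = "\<lambda>g r. indicator {0..s} r *\<^sub>R (exp (total_rate \<omega> x r) * b r x \<omega> * (g r (x + 1) + g r (x - 1)))"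
  have one: "unit_valued (\<lambda>_ _. 1)" by (simp add: unit_valued_def)
  have i: "integrable lborel (?I (g n))" for n
    using first_jump_integrand_integrable[OF g] by (simp add: set_integrable_def)
  have l: "(\<lambda>n. ?I (g n) r) \<longlonglongrightarrow> ?I h r" for r by (intro tendsto_intros lim)
  have m: "?I h \<in> borel_measurable lborel"
    by (rule borel_measurable_LIMSEQ_real[of lborel "\<lambda>n. ?I (g n)"]) (use i l in auto)
  have "(\<lambda>n. \<integral>r. ?I (g n) r \<partial>lborel) \<longlonglongrightarrow> (\<integral>r. ?I h r \<partial>lborel)"
  proof (rule integral_dominated_convergence[OF m _ _ AE_I2[OF l] AE_I2])
    show "integrable lborel (?I (\<lambda>_ _. 1))"
      using first_jump_integrand_integrable[OF one] by (simp add: set_integrable_def)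
    show "norm (?I (g n) r) \<le> ?I (\<lambda>_ _. 1) r" for n r
      using unit_valuedD(2,3)[OF g[of n], of r "x + 1"] unit_valuedD(2,3)[OF g[of n], of r "x - 1"]
        conductance_pos[OF \<omega>, of r x]
      by (auto simp: indicator_def abs_mult)
  qed (use i in auto)
  then show ?thesis
    unfolding first_jump_def set_lebesgue_integral_def by (intro tendsto_intros c)
qed

text \<open>A fixed point has the form \<open>e\<^bsup>-B\<^esup> (c + \<integral> e\<^sup>B h)\<close> with \<open>B\<close> the total rate and \<open>h\<close> the gain term, so the product rule
  makes it a solution of \<open>g' = h - B' g\<close>.\<close>
lemma first_jump_derivative:
  assumes g: "unit_valued g" and eq: "\<And>s. 0 \<le> s \<Longrightarrow> g s x = first_jump \<omega> c g s x"
  shows "has_lebesgue_derivative T (\<lambda>s. g s x) (\<lambda>s. b s x \<omega> * (g s (x + 1) + g s (x - 1) - 2 * g s x))"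
proof -
  let ?I = "\<lambda>r. exp (total_rate \<omega> x r) * b r x \<omega> * (g r (x + 1) + g r (x - 1))"
  let ?J = "\<lambda>s. c x + (LBINT r:{0..s}. ?I r)"
  have 1: "has_lebesgue_derivative T ?J ?I"
    using first_jump_integrand_integrable[OF g]
    by (auto simp: has_lebesgue_derivative_def set_integral_singleton_eq_0 simp del: atLeastAtMost_singleton)
  have "has_lebesgue_derivative T (\<lambda>s. - total_rate \<omega> x s) (\<lambda>s. - (2 * b s x \<omega>))"
    using has_lebesgue_derivative_cmult[OF total_rate_derivative, of T "-1" x] by simp
  then have 2: "has_lebesgue_derivative T (\<lambda>s. exp (- total_rate \<omega> x s)) (\<lambda>s. exp (- total_rate \<omega> x s) * - (2 * b s x \<omega>))"
    by (rule has_lebesgue_derivative_exp)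
  have "has_lebesgue_derivative T (\<lambda>s. exp (- total_rate \<omega> x s) * ?J s)
      (\<lambda>s. ?J s * (exp (- total_rate \<omega> x s) * - (2 * b s x \<omega>)) + exp (- total_rate \<omega> x s) * ?I s)"
    by (rule has_lebesgue_derivative_mult[OF 2 1])
  moreover have J: "exp (- total_rate \<omega> x s) * ?J s = g s x" if "0 \<le> s" for s
    using eq[OF that] by (simp add: first_jump_def)
  moreover have "?J s * (exp (- total_rate \<omega> x s) * - (2 * b s x \<omega>)) + exp (- total_rate \<omega> x s) * ?I s
      = b s x \<omega> * (g s (x + 1) + g s (x - 1) - 2 * g s x)" if "0 \<le> s" for s
    unfolding J[OF that, symmetric] by (simp add: algebra_simps exp_minus)
  ultimately show ?thesis
    by (rule has_lebesgue_derivative_cong)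
qed

text \<open>The recursion is linear, and the Kronecker deltas over \<open>Y\<close> add up to the indicator of \<open>Y\<close>.\<close>
lemma kernel_approx_sum_Suc:
  assumes "\<And>y. y \<in> Y \<Longrightarrow> unit_valued (\<lambda>r x. dual_kernel_approx b \<omega> n r x 0 y)" and "finite Y"
  shows "(\<Sum>y\<in>Y. dual_kernel_approx b \<omega> (Suc n) s x 0 y) =
     first_jump \<omega> (\<lambda>x. of_bool (x \<in> Y)) (\<lambda>r x. \<Sum>y\<in>Y. dual_kernel_approx b \<omega> n r x 0 y) s x"
proof -
  have "(\<Sum>y\<in>Y. dual_kernel_approx b \<omega> (Suc n) s x 0 y) =
      first_jump \<omega> (\<lambda>x. \<Sum>y\<in>Y. of_bool (x = y)) (\<lambda>r x. \<Sum>y\<in>Y. dual_kernel_approx b \<omega> n r x 0 y) s x"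
    unfolding kernel_approx_Suc by (rule first_jump_sum[OF assms(1)])
  moreover have "(\<Sum>y\<in>Y. of_bool (x = y)) = (of_bool (x \<in> Y) :: real)" for x
    using assms(2) by (simp add: of_bool_def)
  ultimately show ?thesis by simp
qed

lemma kernel_approx_measurable_time:
  "(\<lambda>r. dual_kernel_approx b \<omega> n r x 0 y) \<in> borel_measurable borel"
proof -
  have "(\<lambda>r::real. (r, \<omega>)) \<in> measurable borel (borel \<Otimes>\<^sub>M M)" using \<omega> by measurable
  from measurable_compose[OF this kernel_approx_measurable[of n x y]] show ?thesis by simp
qed

lemma unit_valued_const: "unit_valued (\<lambda>_ _. 0)" "unit_valued (\<lambda>_ _. 1)"
  by (simp_all add: unit_valued_def)

text \<open>By monotonicity of the recursion the iterates stay between its fixed points \<open>0\<close> and \<open>1\<close>.\<close>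
lemma kernel_approx_sum_unit_valued:
  "finite Y \<Longrightarrow> unit_valued (\<lambda>r x. \<Sum>y\<in>Y. dual_kernel_approx b \<omega> n r x 0 y)"
proof (induction n arbitrary: Y)
  case 0 then show ?case by (simp add: unit_valued_const)
next
  case (Suc n)
  have 1: "unit_valued (\<lambda>r x. dual_kernel_approx b \<omega> n r x 0 y)" for y
    using Suc.IH[of "{y}"] by simp
  note eq = kernel_approx_sum_Suc[OF 1 Suc.prems]
  have "(\<Sum>y\<in>Y. dual_kernel_approx b \<omega> (Suc n) s x 0 y) \<le> first_jump \<omega> (\<lambda>_. 1) (\<lambda>_ _. 1) s x" for s x
    unfolding eq using unit_valuedD(3)[OF Suc.IH[OF Suc.prems]]
    by (intro first_jump_mono Suc.IH Suc.prems unit_valued_const) auto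
  moreover have "first_jump \<omega> (\<lambda>_. 0) (\<lambda>_ _. 0) s x \<le> (\<Sum>y\<in>Y. dual_kernel_approx b \<omega> (Suc n) s x 0 y)" for s x
    unfolding eq using unit_valuedD(2)[OF Suc.IH[OF Suc.prems]]
    by (intro first_jump_mono Suc.IH Suc.prems unit_valued_const) auto
  ultimately show ?case
    unfolding unit_valued_def
    by (auto simp: first_jump_one first_jump_def[of _ "\<lambda>_. 0"] simp del: dual_kernel_approx.simps
        intro!: borel_measurable_sum kernel_approx_measurable_time)
qed

lemma kernel_approx_unit_valued: "unit_valued (\<lambda>r x. dual_kernel_approx b \<omega> n r x 0 y)"
  using kernel_approx_sum_unit_valued[of "{y}" n] by simp

lemma kernel_approx_mono:
  "dual_kernel_approx b \<omega> n s x 0 y \<le> dual_kernel_approx b \<omega> (Suc n) s x 0 y"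
proof (induction n arbitrary: s x)
  case 0 then show ?case
    using unit_valuedD(2)[OF kernel_approx_unit_valued[of "Suc 0" y]]
    by (simp only: dual_kernel_approx.simps(1))
next
  case (Suc n)
  show ?case
    unfolding kernel_approx_Suc[of "Suc n"] kernel_approx_Suc[of n s x]
    by (intro first_jump_mono kernel_approx_unit_valued order_refl Suc)
qed

lemma kernel_approx_limit:
  "(\<lambda>n. dual_kernel_approx b \<omega> n s x 0 y) \<longlonglongrightarrow> dual_kernel b \<omega> s x 0 y"
proof -
  have "incseq (\<lambda>n. dual_kernel_approx b \<omega> n s x 0 y)"
    using kernel_approx_mono by (intro incseq_SucI)
  then have "convergent (\<lambda>n. dual_kernel_approx b \<omega> n s x 0 y)"
    using unit_valuedD(3)[OF kernel_approx_unit_valued]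
    by (metis incseq_convergent convergent_def)
  then show ?thesis by (simp add: convergent_LIMSEQ_iff dual_kernel_def)
qed

lemma dual_kernel_nonneg: "0 \<le> dual_kernel b \<omega> s x 0 y"
  using unit_valuedD(2)[OF kernel_approx_unit_valued] by (intro LIMSEQ_le_const[OF kernel_approx_limit]) auto

lemma dual_kernel_sum_le_1:
  assumes "finite Y"
  shows "(\<Sum>y\<in>Y. dual_kernel b \<omega> s x 0 y) \<le> 1"
  using unit_valuedD(3)[OF kernel_approx_sum_unit_valued[OF assms]]
  by (intro LIMSEQ_le_const2[OF tendsto_sum[OF kernel_approx_limit]]) auto

lemma dual_kernel_summable: "(\<lambda>y. dual_kernel b \<omega> s x 0 y) summable_on Y"
  by (rule nonneg_bdd_above_summable_on)
    (auto intro!: bdd_aboveI[where M = 1] dual_kernel_sum_le_1 dual_kernel_nonneg)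

lemma dual_mass_finite: "finite Y \<Longrightarrow> dual_mass \<omega> Y s x = (\<Sum>y\<in>Y. dual_kernel b \<omega> s x 0 y)"
  by (simp add: dual_mass_def)

lemma dual_mass_window_limit:
  "(\<lambda>k. \<Sum>y\<in>Y \<inter> {- int k..int k}. dual_kernel b \<omega> s x 0 y) \<longlonglongrightarrow> dual_mass \<omega> Y s x"
  unfolding dual_mass_def by (rule window_sums_tendsto_infsum[OF dual_kernel_summable])

lemma dual_mass_nonneg: "0 \<le> dual_mass \<omega> Y s x"
  unfolding dual_mass_def by (intro infsum_nonneg dual_kernel_nonneg)

lemma dual_mass_mono: "Y \<subseteq> Z \<Longrightarrow> dual_mass \<omega> Y s x \<le> dual_mass \<omega> Z s x"
  unfolding dual_mass_def by (intro infsum_mono_neutral dual_kernel_summable) (auto intro: dual_kernel_nonneg)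

lemma dual_mass_le_1: "dual_mass \<omega> Y s x \<le> 1"
  by (rule LIMSEQ_le_const2[OF dual_mass_window_limit]) (auto intro!: dual_kernel_sum_le_1)

lemma dual_mass_compl: "dual_mass \<omega> Y s x + dual_mass \<omega> (- Y) s x = dual_mass \<omega> UNIV s x"
  unfolding dual_mass_def
  by (subst infsum_Un_disjoint[symmetric]) (auto intro: dual_kernel_summable)

lemma dual_mass_unit_valued: "unit_valued (dual_mass \<omega> Y)"
  unfolding unit_valued_def
proof (intro conjI allI dual_mass_nonneg dual_mass_le_1)
  fix x
  have 1: "(\<lambda>r. dual_kernel b \<omega> r x 0 y) \<in> borel_measurable borel" for y
    by (rule borel_measurable_LIMSEQ_real[OF kernel_approx_limit])
      (use kernel_approx_measurable_time in simp_all)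
  show "(\<lambda>r. dual_mass \<omega> Y r x) \<in> borel_measurable borel"
    by (rule borel_measurable_LIMSEQ_real[OF dual_mass_window_limit]) (use 1 in simp_all)
qed

text \<open>For finite \<open>Y\<close> the recursion passes to the limit of the iterates; an arbitrary \<open>Y\<close> is exhausted by its finite
  windows. Both limits are covered by \<open>first_jump_limit\<close>.\<close>
lemma dual_mass_first_jump:
  "dual_mass \<omega> Y s x = first_jump \<omega> (\<lambda>x. of_bool (x \<in> Y)) (dual_mass \<omega> Y) s x"
proof -
  have fin: "dual_mass \<omega> F s x = first_jump \<omega> (\<lambda>x. of_bool (x \<in> F)) (dual_mass \<omega> F) s x"
    if F: "finite F" for F s x
  proof -
    have "(\<lambda>n. \<Sum>y\<in>F. dual_kernel_approx b \<omega> (Suc n) s x 0 y) \<longlonglongrightarrow>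
        first_jump \<omega> (\<lambda>x. of_bool (x \<in> F)) (dual_mass \<omega> F) s x"
      unfolding kernel_approx_sum_Suc[OF kernel_approx_unit_valued F] dual_mass_finite[OF F, abs_def]
      by (intro first_jump_limit kernel_approx_sum_unit_valued F tendsto_sum kernel_approx_limit tendsto_const)
    moreover have "(\<lambda>n. \<Sum>y\<in>F. dual_kernel_approx b \<omega> (Suc n) s x 0 y) \<longlonglongrightarrow> dual_mass \<omega> F s x"
      unfolding dual_mass_finite[OF F] by (intro tendsto_sum LIMSEQ_Suc kernel_approx_limit)
    ultimately show ?thesis by (rule LIMSEQ_unique[rotated])
  qed
  have lim: "(\<lambda>k. dual_mass \<omega> (Y \<inter> {- int k..int k}) s x) \<longlonglongrightarrow> dual_mass \<omega> Y s x" for s x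
    using dual_mass_window_limit by (simp add: dual_mass_finite)
  have "(\<lambda>k. of_bool (x \<in> Y \<inter> {- int k..int k}) :: real) \<longlonglongrightarrow> of_bool (x \<in> Y)"
    by (rule tendsto_eventually) (auto intro!: eventually_sequentiallyI[of "nat \<bar>x\<bar>"])
  then have "(\<lambda>k. first_jump \<omega> (\<lambda>x. of_bool (x \<in> Y \<inter> {- int k..int k})) (dual_mass \<omega> (Y \<inter> {- int k..int k})) s x)
      \<longlonglongrightarrow> first_jump \<omega> (\<lambda>x. of_bool (x \<in> Y)) (dual_mass \<omega> Y) s x"
    by (intro first_jump_limit dual_mass_unit_valued lim)
  with lim[of s x] show ?thesis
    unfolding fin[of "Y \<inter> {- int _..int _}" s x, OF finite_Int[OF disjI2[OF finite_atLeastAtMost_int]]]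
    by (rule LIMSEQ_unique)
qed

lemma dual_mass_derivative:
  "has_lebesgue_derivative T (\<lambda>s. dual_mass \<omega> Y s x)
     (\<lambda>s. b s x \<omega> * (dual_mass \<omega> Y s (x + 1) + dual_mass \<omega> Y s (x - 1) - 2 * dual_mass \<omega> Y s x))"
  by (rule first_jump_derivative[OF dual_mass_unit_valued dual_mass_first_jump])

lemma dual_mass_start: "dual_mass \<omega> Y 0 x = of_bool (x \<in> Y)"
  unfolding dual_mass_first_jump[of Y 0 x] first_jump_def
  by (simp add: set_integral_singleton_eq_0 total_rate_0 del: atLeastAtMost_singleton)

lemma dual_mass_tail_limit: "(\<lambda>n. dual_mass \<omega> {y. int n \<le> \<bar>y\<bar>} s x) \<longlonglongrightarrow> 0"
proof -
  have eq: "dual_mass \<omega> {y. int (Suc n) \<le> \<bar>y\<bar>} s x =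
      dual_mass \<omega> UNIV s x - (\<Sum>y\<in>UNIV \<inter> {- int n..int n}. dual_kernel b \<omega> s x 0 y)" for n
  proof -
    have "- (UNIV \<inter> {- int n..int n}) = {y. int (Suc n) \<le> \<bar>y\<bar>}" by auto
    then show ?thesis
      using dual_mass_compl[of "UNIV \<inter> {- int n..int n}" s x] by (simp add: dual_mass_finite)
  qed
  have "(\<lambda>n. dual_mass \<omega> {y. int (Suc n) \<le> \<bar>y\<bar>} s x) \<longlonglongrightarrow> dual_mass \<omega> UNIV s x - dual_mass \<omega> UNIV s x"
    unfolding eq by (intro tendsto_diff tendsto_const dual_mass_window_limit)
  then show ?thesis by (simp only: diff_self LIMSEQ_imp_Suc)
qed

text \<open>The defect \<open>d = 1 - dual_mass \<omega> UNIV\<close> is nonnegative and solves the recursion with zero initial datum. If it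
  vanishes at \<open>(T, x)\<close>, then so does the integral of its neighbouring values against a strictly positive
  weight.\<close>
lemma mass_conserved_before:
  assumes T: "dual_mass \<omega> UNIV T x = 1"
  shows "AE r in lborel. r \<in> {0..T} \<longrightarrow> dual_mass \<omega> UNIV r (x + 1) = 1 \<and> dual_mass \<omega> UNIV r (x - 1) = 1"
proof -
  let ?d = "\<lambda>r x. 1 - dual_mass \<omega> UNIV r x"
  let ?I = "\<lambda>g r. exp (total_rate \<omega> x r) * b r x \<omega> * (g r (x + 1) + g r (x - 1) :: real)"
  have int: "set_integrable lborel {0..T} (?I g)" if "unit_valued g" for g
    by (rule first_jump_integrand_integrable[OF that])
  have d: "unit_valued ?d"
    using unit_valuedD[OF dual_mass_unit_valued[of UNIV]] unfolding unit_valued_def by auto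
  have "first_jump \<omega> (\<lambda>_. 1) (\<lambda>_ _. 1) T x = first_jump \<omega> (\<lambda>_. 1) (dual_mass \<omega> UNIV) T x"
    using T dual_mass_first_jump[of UNIV T x] by (simp add: first_jump_one)
  then have "(LBINT r:{0..T}. ?I (\<lambda>_ _. 1) r) - (LBINT r:{0..T}. ?I (dual_mass \<omega> UNIV) r) = 0"
    by (simp add: first_jump_def)
  then have "(LBINT r:{0..T}. ?I (\<lambda>_ _. 1) r - ?I (dual_mass \<omega> UNIV) r) = 0"
    unfolding set_integral_diff(2)[OF int[OF unit_valued_const(2)] int[OF dual_mass_unit_valued]] .
  then have 0: "(\<integral>r. indicator {0..T} r *\<^sub>R ?I ?d r \<partial>lborel) = 0"
    by (simp add: set_lebesgue_integral_def algebra_simps)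
  have nn: "0 \<le> indicator {0..T} r *\<^sub>R ?I ?d r" for r
    using unit_valuedD(2)[OF d] conductance_pos[OF \<omega>, of r x]
    by (intro scaleR_nonneg_nonneg mult_nonneg_nonneg add_nonneg_nonneg) (simp_all add: less_imp_le)
  have "AE r in lborel. indicator {0..T} r *\<^sub>R ?I ?d r = 0"
    using integral_nonneg_eq_0_iff_AE[OF int[OF d, unfolded set_integrable_def] AE_I2[OF nn]] 0 by blast
  then show ?thesis
  proof eventually_elim
    case (elim r)
    then show ?case
      using unit_valuedD(2)[OF d, of r "x + 1"] unit_valuedD(2)[OF d, of r "x - 1"] conductance_pos[OF \<omega>, of r x]
      by (auto simp: indicator_def split: if_splits)
  qed
qed

end

lemma dual_mass_shift:
  assumes "\<omega> \<in> space M"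
  shows "dual_mass (\<tau> 0 z \<omega>) Y s x = dual_mass \<omega> ((\<lambda>y. y + z) ` Y) s (x + z)"
  unfolding dual_mass_def kernel_shift[OF assms] by (subst infsum_reindex) (auto simp: o_def)

lemma dual_mass_measurable:
  "(\<lambda>p. dual_mass (snd p) Y (fst p) x) \<in> borel_measurable (borel \<Otimes>\<^sub>M M)"
proof (rule borel_measurable_LIMSEQ_real)
  show "(\<lambda>k. \<Sum>y\<in>Y \<inter> {- int k..int k}. dual_kernel b (snd p) (fst p) x 0 y) \<longlonglongrightarrow> dual_mass (snd p) Y (fst p) x"
    if "p \<in> space (borel \<Otimes>\<^sub>M M)" for p
    using that by (intro dual_mass_window_limit) (auto simp: space_pair_measure)
qed (intro borel_measurable_sum dual_kernel_measurable)

section \<open>Green identity\<close>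

text \<open>The current in the Green identity for the solution \<open>\<phi>\<circ>\<tau>\<close> of the forward equation and the solution
  \<open>dual_mass \<omega> Y\<close> of the backward equation, across the bond from \<open>x\<close> to \<open>x + 1\<close>.\<close>
definition flux :: "('a \<Rightarrow> real) \<Rightarrow> int set \<Rightarrow> int \<Rightarrow> real \<Rightarrow> 'a \<Rightarrow> real" where
  "flux \<phi> Y x s \<omega> = b s x \<omega> * \<phi> (\<tau> s x \<omega>) * dual_mass \<omega> Y s (x + 1)
     - dual_mass \<omega> Y s x * (b s (x + 1) \<omega> * \<phi> (\<tau> s (x + 1) \<omega>))"

lemma flux_integrable_time:
  assumes \<omega>: "\<omega> \<in> space M" and f: "\<And>x. set_integrable lborel {0..T} (\<lambda>u. b u x \<omega> * \<phi> (\<tau> u x \<omega>))"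
  shows "set_integrable lborel {0..T} (\<lambda>s. flux \<phi> Y x s \<omega>)"
  unfolding flux_def
  using has_lebesgue_derivative_mult_integrable[OF dual_mass_derivative[OF \<omega>] f]
  by (intro set_integral_diff(1)) (simp_all add: mult.commute[of "_ * _" "dual_mass _ _ _ _"])

text \<open>The diagonal terms \<open>2 b \<phi> u\<close> of the two equations cancel in the derivative of the product, and what remains is
  a discrete gradient. There is no contribution from time \<open>0\<close> because the mass starts as the indicator of
  \<open>Y\<close>, which vanishes on the window.\<close>
lemma green_identity:
  assumes \<omega>: "\<omega> \<in> space M" and "0 \<le> T" and "a \<le> c + 1" and "{a..c} \<inter> Y = {}"
    and f: "\<And>x. set_integrable lborel {0..T} (\<lambda>u. b u x \<omega> * \<phi> (\<tau> u x \<omega>))"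
    and \<phi>: "\<And>x. has_lebesgue_derivative T (\<lambda>s. \<phi> (\<tau> s x \<omega>))
       (\<lambda>u. - b u (x + 1) \<omega> * \<phi> (\<tau> u (x + 1) \<omega>) - b u (x - 1) \<omega> * \<phi> (\<tau> u (x - 1) \<omega>)
            + 2 * b u x \<omega> * \<phi> (\<tau> u x \<omega>))"
  shows "(\<Sum>x\<in>{a..c}. \<phi> (\<tau> T x \<omega>) * dual_mass \<omega> Y T x) =
    (LBINT s:{0..T}. flux \<phi> Y c s \<omega>) - (LBINT s:{0..T}. flux \<phi> Y (a - 1) s \<omega>)"
proof -
  have "has_lebesgue_derivative T (\<lambda>s. \<phi> (\<tau> s x \<omega>) * dual_mass \<omega> Y s x) (\<lambda>s. flux \<phi> Y x s \<omega> - flux \<phi> Y (x - 1) s \<omega>)" for x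
    by (rule has_lebesgue_derivative_cong[OF has_lebesgue_derivative_mult[OF \<phi> dual_mass_derivative[OF \<omega>]]])
      (simp_all add: flux_def algebra_simps)
  then have d: "has_lebesgue_derivative T (\<lambda>s. \<Sum>x\<in>{a..c}. \<phi> (\<tau> s x \<omega>) * dual_mass \<omega> Y s x)
      (\<lambda>s. \<Sum>x\<in>{a..c}. flux \<phi> Y x s \<omega> - flux \<phi> Y (x - 1) s \<omega>)"
    by (rule has_lebesgue_derivative_sum)
  have "(\<Sum>x\<in>{a..c}. \<phi> (\<tau> 0 x \<omega>) * dual_mass \<omega> Y 0 x) = 0"
    using assms(4) by (intro sum.neutral) (auto simp: dual_mass_start[OF \<omega>])
  then have "(\<Sum>x\<in>{a..c}. \<phi> (\<tau> T x \<omega>) * dual_mass \<omega> Y T x) =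
      (LBINT s:{0..T}. flux \<phi> Y c s \<omega> - flux \<phi> Y (a - 1) s \<omega>)"
    using has_lebesgue_derivativeD(2)[OF d, of T] \<open>0 \<le> T\<close>
      sum_telescope_int[OF assms(3), of "\<lambda>x. flux \<phi> Y x _ \<omega>"] by simp
  then show ?thesis
    using set_integral_diff(2)[OF flux_integrable_time flux_integrable_time, OF \<omega> f \<omega> f] by simp
qed

text \<open>The flux is linear in the mass, and the masses of \<open>Y\<close> and its complement add up to \<open>1\<close> at almost every
  time.\<close>
lemma flux_complementary_sum:
  assumes \<omega>: "\<omega> \<in> space M" and mass: "\<And>x. dual_mass \<omega> UNIV T x = 1"
    and f: "\<And>x. set_integrable lborel {0..T} (\<lambda>u. b u x \<omega> * \<phi> (\<tau> u x \<omega>))"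
  shows "(LBINT s:{0..T}. flux \<phi> Y x s \<omega>) + (LBINT s:{0..T}. flux \<phi> (- Y) x s \<omega>) =
    (LBINT s:{0..T}. b s x \<omega> * \<phi> (\<tau> s x \<omega>) - b s (x + 1) \<omega> * \<phi> (\<tau> s (x + 1) \<omega>))"
proof -
  note i = flux_integrable_time[where \<phi> = \<phi>, OF \<omega> f]
  have "(LBINT s:{0..T}. flux \<phi> Y x s \<omega>) + (LBINT s:{0..T}. flux \<phi> (- Y) x s \<omega>) =
      (LBINT s:{0..T}. flux \<phi> Y x s \<omega> + flux \<phi> (- Y) x s \<omega>)"
    using set_integral_add(2)[OF i i] by simp
  also have "\<dots> = (LBINT s:{0..T}. b s x \<omega> * \<phi> (\<tau> s x \<omega>) - b s (x + 1) \<omega> * \<phi> (\<tau> s (x + 1) \<omega>))"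
    unfolding set_lebesgue_integral_def
  proof (rule integral_cong_AE)
    show "(\<lambda>s. indicator {0..T} s *\<^sub>R (flux \<phi> Y x s \<omega> + flux \<phi> (- Y) x s \<omega>)) \<in> borel_measurable lborel"
      using set_integral_add(1)[OF i i] unfolding set_integrable_def by auto
    show "(\<lambda>s. indicator {0..T} s *\<^sub>R (b s x \<omega> * \<phi> (\<tau> s x \<omega>) - b s (x + 1) \<omega> * \<phi> (\<tau> s (x + 1) \<omega>)))
        \<in> borel_measurable lborel"
      using set_integral_diff(1)[OF f f] unfolding set_integrable_def by auto
    show "AE s in lborel. indicator {0..T} s *\<^sub>R (flux \<phi> Y x s \<omega> + flux \<phi> (- Y) x s \<omega>) =
        indicator {0..T} s *\<^sub>R (b s x \<omega> * \<phi> (\<tau> s x \<omega>) - b s (x + 1) \<omega> * \<phi> (\<tau> s (x + 1) \<omega>))"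
      \<comment> \<open>Mass one at time \<open>T\<close> at \<open>x - 1\<close> and at \<open>x\<close> gives mass one at earlier times at \<open>x\<close> and at \<open>x + 1\<close>.\<close>
      using mass_conserved_before[OF \<omega> mass[of "x - 1"]] mass_conserved_before[OF \<omega> mass[of x]]
    proof eventually_elim
      case (elim s)
      show ?case
      proof (cases "s \<in> {0..T}")
        case True
        have "dual_mass \<omega> (- Y) s z = 1 - dual_mass \<omega> Y s z" if "z = x \<or> z = x + 1" for z
          using elim True that dual_mass_compl[OF \<omega>, of Y s z] by auto
        from this[of x] this[of "x + 1"] show ?thesis
          by (simp add: flux_def right_diff_distrib left_diff_distrib)
      qed simp
    qed
  qed
  finally show ?thesis .
qed

section \<open>Stationarity and conservation of mass\<close>

lemma shift_measurable_fixed [measurable]: "\<tau> t x \<in> measurable M M"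
proof -
  have "(\<lambda>\<omega>. (t, x, \<omega>)) \<in> measurable M (borel \<Otimes>\<^sub>M count_space UNIV \<Otimes>\<^sub>M M)" by measurable
  from measurable_compose[OF this shift_measurable] show ?thesis by simp
qed

lemma shift_measurable_compose [measurable (raw)]:
  assumes "f \<in> borel_measurable N" "g \<in> measurable N M"
  shows "(\<lambda>q. \<tau> (f q) x (g q)) \<in> measurable N M"
proof -
  have "(\<lambda>q. (f q, x, g q)) \<in> measurable N (borel \<Otimes>\<^sub>M count_space UNIV \<Otimes>\<^sub>M M)"
    using assms by measurable
  from measurable_compose[OF this shift_measurable] show ?thesis by simp
qed

lemma AE_shift: "AE \<omega> in M. P \<omega> \<Longrightarrow> AE \<omega> in M. P (\<tau> t x \<omega>)"
  using AE_distrD[where f = "\<tau> t x" and P = P, OF shift_measurable_fixed] unfolding shift_invariant .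

lemma integral_shift:
  fixes g :: "'a \<Rightarrow> real"
  assumes "g \<in> borel_measurable M"
  shows "(\<integral>\<omega>. g (\<tau> t x \<omega>) \<partial>M) = (\<integral>\<omega>. g \<omega> \<partial>M)"
  using integral_distr[OF shift_measurable_fixed assms, of t x] by (simp add: shift_invariant)

lemma integrable_shift:
  fixes g :: "'a \<Rightarrow> real"
  assumes "integrable M g"
  shows "integrable M (\<lambda>\<omega>. g (\<tau> t x \<omega>))"
  using integrable_distr[OF shift_measurable_fixed, of t x g] assms by (simp add: shift_invariant)

lemma dual_kernel_measurable_env [measurable]: "(\<lambda>\<omega>. dual_kernel b \<omega> s x 0 y) \<in> borel_measurable M"
proof -
  have "(\<lambda>\<omega>. (s, \<omega>)) \<in> measurable M (borel \<Otimes>\<^sub>M M)" by measurable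
  from measurable_compose[OF this dual_kernel_measurable] show ?thesis by simp
qed

lemma dual_mass_measurable_env [measurable]: "(\<lambda>\<omega>. dual_mass \<omega> Y s x) \<in> borel_measurable M"
proof -
  have "(\<lambda>\<omega>. (s, \<omega>)) \<in> measurable M (borel \<Otimes>\<^sub>M M)" by measurable
  from measurable_compose[OF this dual_mass_measurable] show ?thesis by simp
qed

text \<open>Taking expectations in \<open>id\<close> and shifting the term of index \<open>x\<close> by \<open>-x\<close> in space turns the sum over the start
  point into a sum over the end point. Hence \<open>\<phi>\<circ>\<tau>\<^bsub>T,0\<^esub>\<close> times the mass has the same expectation as
  \<open>\<phi>\<circ>\<tau>\<^bsub>T,0\<^esub>\<close>, although the mass is at most \<open>1\<close> and \<open>\<phi>\<close> is positive.\<close>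
lemma mass_conserved:
  assumes \<phi>: "integrable M \<phi>" and pos: "AE \<omega> in M. 0 < \<phi> \<omega>"
    and id: "AE \<omega> in M. ((\<lambda>x. \<phi> (\<tau> T x \<omega>) * dual_kernel b \<omega> T x 0 0) has_sum \<phi> \<omega>) UNIV"
  shows "AE \<omega> in M. \<forall>x. dual_mass \<omega> UNIV T x = 1"
proof -
  let ?W = "\<lambda>k. UNIV \<inter> {- int k..int k}"
  let ?p = "\<lambda>\<omega>. \<phi> (\<tau> T 0 \<omega>)"
  have [measurable]: "\<phi> \<in> borel_measurable M" using \<phi> by simp
  have p: "integrable M ?p" by (rule integrable_shift[OF \<phi>])
  have pos': "AE \<omega> in M. \<forall>x. 0 < \<phi> (\<tau> T x \<omega>)"
    unfolding AE_all_countable using AE_shift[OF pos] by blast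
  have K1: "dual_kernel b \<omega> s x 0 y \<le> 1" if "\<omega> \<in> space M" for \<omega> s x y
    using dual_kernel_sum_le_1[OF that, of "{y}"] by simp
  have pK: "integrable M (\<lambda>\<omega>. ?p \<omega> * dual_kernel b \<omega> T 0 0 y)" for y
    by (rule Bochner_Integration.integrable_bound[OF p])
      (use K1 dual_kernel_nonneg in \<open>auto simp: abs_mult intro!: AE_I2 mult_left_le\<close>)
  have shift: "?p (\<tau> 0 x \<omega>) * dual_kernel b (\<tau> 0 x \<omega>) T 0 0 (- x) = \<phi> (\<tau> T x \<omega>) * dual_kernel b \<omega> T x 0 0"
    if "\<omega> \<in> space M" for x \<omega>
    using that by (simp add: kernel_shift shift_add)
  have i1: "integrable M (\<lambda>\<omega>. \<phi> (\<tau> T x \<omega>) * dual_kernel b \<omega> T x 0 0)" for x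
    using integrable_shift[OF pK[of "- x"], of 0 x] shift by (simp cong: Bochner_Integration.integrable_cong)
  have e1: "(\<integral>\<omega>. \<phi> (\<tau> T x \<omega>) * dual_kernel b \<omega> T x 0 0 \<partial>M) = (\<integral>\<omega>. ?p \<omega> * dual_kernel b \<omega> T 0 0 (- x) \<partial>M)" for x
    using integral_shift[of "\<lambda>\<omega>. ?p \<omega> * dual_kernel b \<omega> T 0 0 (- x)" 0 x] shift
    by (simp cong: Bochner_Integration.integral_cong)
  have "(\<lambda>k. \<integral>\<omega>. (\<Sum>x\<in>?W k. \<phi> (\<tau> T x \<omega>) * dual_kernel b \<omega> T x 0 0) \<partial>M) \<longlonglongrightarrow> (\<integral>\<omega>. \<phi> \<omega> \<partial>M)"
  proof (rule integral_dominated_convergence[where w = \<phi>])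
    show "AE \<omega> in M. (\<lambda>k. \<Sum>x\<in>?W k. \<phi> (\<tau> T x \<omega>) * dual_kernel b \<omega> T x 0 0) \<longlonglongrightarrow> \<phi> \<omega>"
      using id by eventually_elim
        (metis window_sums_tendsto_infsum has_sum_imp_summable infsumI)
    show "AE \<omega> in M. norm (\<Sum>x\<in>?W k. \<phi> (\<tau> T x \<omega>) * dual_kernel b \<omega> T x 0 0) \<le> \<phi> \<omega>" for k
      using id pos' AE_space
    proof eventually_elim
      case (elim \<omega>)
      have nn: "0 \<le> \<phi> (\<tau> T x \<omega>) * dual_kernel b \<omega> T x 0 0" for x
        using elim dual_kernel_nonneg[OF elim(3)] by (simp add: less_imp_le)
      have "(\<Sum>x\<in>?W k. \<phi> (\<tau> T x \<omega>) * dual_kernel b \<omega> T x 0 0) \<le> \<phi> \<omega>"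
        by (rule finite_sum_le_has_sum[OF elim(1)]) (use nn in auto)
      then show ?case using nn by (simp add: sum_nonneg)
    qed
  qed (use \<phi> i1 in auto)
  moreover have "(\<integral>\<omega>. (\<Sum>x\<in>?W k. \<phi> (\<tau> T x \<omega>) * dual_kernel b \<omega> T x 0 0) \<partial>M) =
      (\<integral>\<omega>. (\<Sum>y\<in>?W k. ?p \<omega> * dual_kernel b \<omega> T 0 0 y) \<partial>M)" for k
  proof -
    have "(\<Sum>x\<in>?W k. \<integral>\<omega>. ?p \<omega> * dual_kernel b \<omega> T 0 0 (- x) \<partial>M) = (\<Sum>y\<in>?W k. \<integral>\<omega>. ?p \<omega> * dual_kernel b \<omega> T 0 0 y \<partial>M)"
      by (rule sum.reindex_bij_witness[of _ uminus uminus]) auto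
    then show ?thesis
      using i1 pK by (simp add: e1 del: Int_UNIV_left)
  qed
  moreover have "(\<lambda>k. \<integral>\<omega>. (\<Sum>y\<in>?W k. ?p \<omega> * dual_kernel b \<omega> T 0 0 y) \<partial>M) \<longlonglongrightarrow> (\<integral>\<omega>. ?p \<omega> * dual_mass \<omega> UNIV T 0 \<partial>M)"
  proof (rule integral_dominated_convergence[where w = "\<lambda>\<omega>. \<bar>?p \<omega>\<bar>"])
    show "AE \<omega> in M. (\<lambda>k. \<Sum>y\<in>?W k. ?p \<omega> * dual_kernel b \<omega> T 0 0 y) \<longlonglongrightarrow> ?p \<omega> * dual_mass \<omega> UNIV T 0"
      unfolding sum_distrib_left[symmetric]
      by (intro AE_I2 tendsto_mult_left dual_mass_window_limit)
    show "AE \<omega> in M. norm (\<Sum>y\<in>?W k. ?p \<omega> * dual_kernel b \<omega> T 0 0 y) \<le> \<bar>?p \<omega>\<bar>" for k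
      unfolding sum_distrib_left[symmetric]
      by (auto simp: abs_mult sum_nonneg dual_kernel_nonneg intro!: AE_I2 mult_left_le dual_kernel_sum_le_1)
  qed (use p in auto)
  ultimately have "(\<integral>\<omega>. \<phi> \<omega> \<partial>M) = (\<integral>\<omega>. ?p \<omega> * dual_mass \<omega> UNIV T 0 \<partial>M)"
    using LIMSEQ_unique by auto
  moreover have "(\<integral>\<omega>. \<phi> \<omega> \<partial>M) = (\<integral>\<omega>. ?p \<omega> \<partial>M)" by (simp add: integral_shift)
  moreover have pm: "integrable M (\<lambda>\<omega>. ?p \<omega> * dual_mass \<omega> UNIV T 0)"
    by (rule Bochner_Integration.integrable_bound[OF p])
      (auto simp: abs_mult dual_mass_nonneg intro!: AE_I2 mult_left_le dual_mass_le_1)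
  ultimately have "(\<integral>\<omega>. ?p \<omega> - ?p \<omega> * dual_mass \<omega> UNIV T 0 \<partial>M) = 0"
    using p by simp
  moreover have "AE \<omega> in M. 0 \<le> ?p \<omega> - ?p \<omega> * dual_mass \<omega> UNIV T 0"
    using pos' AE_space by eventually_elim (simp add: mult_left_le dual_mass_le_1 less_imp_le)
  ultimately have "AE \<omega> in M. ?p \<omega> - ?p \<omega> * dual_mass \<omega> UNIV T 0 = 0"
    using integral_nonneg_eq_0_iff_AE[OF Bochner_Integration.integrable_diff[OF p pm]] by blast
  with pos' have "AE \<omega> in M. dual_mass \<omega> UNIV T 0 = 1"
    by eventually_elim (metis eq_iff_diff_eq_0 less_irrefl mult_cancel_left1)
  from AE_shift[OF this] have "AE \<omega> in M. dual_mass (\<tau> 0 x \<omega>) UNIV T 0 = 1" for x .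
  then have "AE \<omega> in M. dual_mass \<omega> UNIV T x = 1" for x
    using AE_space by eventually_elim (use dual_mass_shift surj_plus_right in auto)
  then show ?thesis by (simp add: AE_all_countable)
qed

section \<open>Vanishing of the boundary flux\<close>

lemma sets_lborel_pair: "sets (lborel \<Otimes>\<^sub>M M) = sets (borel \<Otimes>\<^sub>M M)"
  by (intro sets_pair_measure_cong) auto

lemma flux_shift:
  assumes "\<omega> \<in> space M"
  shows "flux \<phi> ((\<lambda>y. y + z) ` Y) (x + z) s \<omega> = flux \<phi> Y x s (\<tau> 0 z \<omega>)"
  by (simp add: flux_def dual_mass_shift[OF assms] conductance_shift[OF assms] shift_add[OF assms] algebra_simps)

text \<open>Stationarity makes the expectation of \<open>|b\<^sub>s(x) \<phi>\<circ>\<tau>\<^bsub>s,x\<^esub>|\<close> independent of \<open>s\<close> and \<open>x\<close>.\<close>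
lemma intensity_integrable:
  fixes \<phi> :: "'a \<Rightarrow> real"
  assumes [measurable]: "\<phi> \<in> borel_measurable M" and f: "integrable M (\<lambda>\<omega>. b 0 0 \<omega> * \<phi> \<omega>)"
  shows "integrable (lborel \<Otimes>\<^sub>M M) (\<lambda>(s, \<omega>). indicator {0..T} s * \<bar>b s x \<omega> * \<phi> (\<tau> s x \<omega>)\<bar>)"
proof -
  interpret L: pair_sigma_finite lborel M ..
  have fm [measurable]: "(\<lambda>p. b (fst p) x (snd p) * \<phi> (\<tau> (fst p) x (snd p))) \<in> borel_measurable (borel \<Otimes>\<^sub>M M)"
    by measurable
  have eq: "b s x \<omega> * \<phi> (\<tau> s x \<omega>) = (\<lambda>\<omega>. b 0 0 \<omega> * \<phi> \<omega>) (\<tau> s x \<omega>)" if "\<omega> \<in> space M" for s \<omega>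
    using that by (simp add: conductance_shift)
  have i: "integrable M (\<lambda>\<omega>. b s x \<omega> * \<phi> (\<tau> s x \<omega>))" for s
  proof -
    have "integrable M (\<lambda>\<omega>. b s x \<omega> * \<phi> (\<tau> s x \<omega>)) = integrable M (\<lambda>\<omega>. (\<lambda>\<omega>. b 0 0 \<omega> * \<phi> \<omega>) (\<tau> s x \<omega>))"
      by (intro Bochner_Integration.integrable_cong refl eq)
    then show ?thesis using integrable_shift[OF f, of s x] by simp
  qed
  have m0: "(\<lambda>\<omega>. \<bar>b 0 0 \<omega> * \<phi> \<omega>\<bar>) \<in> borel_measurable M" by measurable
  have e: "(\<integral>\<omega>. \<bar>b s x \<omega> * \<phi> (\<tau> s x \<omega>)\<bar> \<partial>M) = (\<integral>\<omega>. \<bar>b 0 0 \<omega> * \<phi> \<omega>\<bar> \<partial>M)" for s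
  proof -
    have "(\<integral>\<omega>. \<bar>b s x \<omega> * \<phi> (\<tau> s x \<omega>)\<bar> \<partial>M) = (\<integral>\<omega>. (\<lambda>\<omega>. \<bar>b 0 0 \<omega> * \<phi> \<omega>\<bar>) (\<tau> s x \<omega>) \<partial>M)"
      by (intro Bochner_Integration.integral_cong refl) (simp only: eq)
    then show ?thesis using integral_shift[OF m0, of s x] by simp
  qed
  show ?thesis
  proof (rule L.Fubini_integrable)
    show "(\<lambda>(s, \<omega>). indicator {0..T} s * \<bar>b s x \<omega> * \<phi> (\<tau> s x \<omega>)\<bar>) \<in> borel_measurable (lborel \<Otimes>\<^sub>M M)"
      unfolding measurable_cong_sets[OF sets_lborel_pair refl] split_beta by measurable
    have "integrable lborel (\<lambda>s. indicator {0..T} s * (\<integral>\<omega>. \<bar>b 0 0 \<omega> * \<phi> \<omega>\<bar> \<partial>M))"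
      by (intro integrable_mult_left integrable_real_indicator) (auto simp: emeasure_lborel_Icc_eq)
    then show "integrable lborel (\<lambda>s. \<integral>\<omega>. norm (case (s, \<omega>) of (s, \<omega>) \<Rightarrow> indicator {0..T} s * \<bar>b s x \<omega> * \<phi> (\<tau> s x \<omega>)\<bar>) \<partial>M)"
      by (simp add: abs_mult[of "indicator _ _"] e)
  qed (use i in auto)
qed

text \<open>After a shift by \<open>- z n\<close> the flux at \<open>z n\<close> becomes a flux at the origin towards a set at distance at least \<open>n\<close>.
  The intensity there is integrable and does not depend on \<open>n\<close>, while the mass of the distant set tends to
  \<open>0\<close>. The conclusion is along a subsequence because the convergence is in \<open>L\<^sup>1\<close>.\<close>
lemma boundary_flux_vanishes:
  fixes \<phi> :: "'a \<Rightarrow> real" and z :: "nat \<Rightarrow> int"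
  assumes [measurable]: "\<phi> \<in> borel_measurable M" and f: "integrable M (\<lambda>\<omega>. b 0 0 \<omega> * \<phi> \<omega>)"
    and far: "\<And>n y. y \<in> Y \<Longrightarrow> int n \<le> \<bar>y - z n\<bar>"
  shows "\<exists>r. strict_mono r \<and> (AE \<omega> in M. (\<lambda>n. LBINT s:{0..T}. flux \<phi> Y (z (r n)) s \<omega>) \<longlonglongrightarrow> 0)"
proof (rule tendsto_L1_AE_subseq)
  interpret L: pair_sigma_finite lborel M ..
  let ?f = "\<lambda>x s \<omega>. b s x \<omega> * \<phi> (\<tau> s x \<omega>)"
  let ?tail = "\<lambda>n. {y::int. int n \<le> \<bar>y\<bar>}"
  \<comment> \<open>\<open>G\<close> is the integrand of the shifted flux, \<open>Q\<close> its bound by the tail masses, \<open>w\<close> the dominating function.\<close>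
  define Z where "Z n = (\<lambda>y. y - z n) ` Y" for n
  define G where "G n s \<omega> = indicator {0..T} s * flux \<phi> (Z n) 0 s \<omega>" for n s \<omega>
  define Q where "Q n = (\<lambda>(s, \<omega>). indicator {0..T} s * \<bar>?f 0 s \<omega>\<bar> * dual_mass \<omega> (?tail n) s 1
      + indicator {0..T} s * \<bar>?f 1 s \<omega>\<bar> * dual_mass \<omega> (?tail n) s 0)" for n
  define w where "w = (\<lambda>(s, \<omega>). indicator {0..T} s * \<bar>?f 0 s \<omega>\<bar> + indicator {0..T} s * \<bar>?f 1 s \<omega>\<bar>)"
  have [measurable]: "(\<lambda>p. dual_mass (snd p) Y (fst p) x) \<in> borel_measurable (borel \<Otimes>\<^sub>M M)" for Y x
    by (rule dual_mass_measurable)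
  have Gm: "case_prod (G n) \<in> borel_measurable (lborel \<Otimes>\<^sub>M M)" for n
    unfolding measurable_cong_sets[OF sets_lborel_pair refl] split_beta G_def flux_def by measurable
  have Qm: "Q n \<in> borel_measurable (lborel \<Otimes>\<^sub>M M)" for n
    unfolding measurable_cong_sets[OF sets_lborel_pair refl] split_beta Q_def by measurable
  have w: "integrable (lborel \<Otimes>\<^sub>M M) w"
    using Bochner_Integration.integrable_add[OF intensity_integrable[OF assms(1) f, of T 0]
        intensity_integrable[OF assms(1) f, of T 1]]
    by (simp add: w_def case_prod_beta')
  have Qw: "0 \<le> Q n p \<and> Q n p \<le> w p" if "p \<in> space (lborel \<Otimes>\<^sub>M M)" for n p
    using that unfolding Q_def w_def
    by (auto simp: space_pair_measure dual_mass_nonneg dual_mass_le_1 intro!: add_mono mult_left_le)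
  have Qi: "integrable (lborel \<Otimes>\<^sub>M M) (Q n)" for n
    by (rule Bochner_Integration.integrable_bound[OF w Qm AE_I2]) (use Qw[of _ n] in force)
  have "(\<lambda>n. \<integral>p. Q n p \<partial>(lborel \<Otimes>\<^sub>M M)) \<longlonglongrightarrow> integral\<^sup>L (lborel \<Otimes>\<^sub>M M) (\<lambda>p :: real \<times> 'a. 0)"
  proof (rule integral_dominated_convergence[where w = w])
    show "AE p in lborel \<Otimes>\<^sub>M M. (\<lambda>n. Q n p) \<longlonglongrightarrow> 0"
    proof (rule AE_I2)
      fix p :: "real \<times> 'a" assume "p \<in> space (lborel \<Otimes>\<^sub>M M)"
      then have "snd p \<in> space M" by (auto simp: space_pair_measure)
      then show "(\<lambda>n. Q n p) \<longlonglongrightarrow> 0"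
        unfolding Q_def split_beta
        by (intro tendsto_add_zero tendsto_mult_right_zero dual_mass_tail_limit)
    qed
    show "AE p in lborel \<Otimes>\<^sub>M M. norm (Q n p) \<le> w p" for n
      using Qw by (intro AE_I2) auto
  qed (use w Qm in simp_all)
  then have Q0: "(\<lambda>n. \<integral>p. Q n p \<partial>(lborel \<Otimes>\<^sub>M M)) \<longlonglongrightarrow> 0" by simp
  have GQ: "\<bar>G n s \<omega>\<bar> \<le> Q n (s, \<omega>)" if \<omega>: "\<omega> \<in> space M" for n s \<omega>
  proof -
    have "Z n \<subseteq> ?tail n" using far by (auto simp: Z_def)
    then have mono: "dual_mass \<omega> (Z n) s x \<le> dual_mass \<omega> (?tail n) s x" for x
      by (rule dual_mass_mono[OF \<omega>])
    have "\<bar>flux \<phi> (Z n) 0 s \<omega>\<bar> \<le> \<bar>?f 0 s \<omega> * dual_mass \<omega> (Z n) s 1\<bar> + \<bar>dual_mass \<omega> (Z n) s 0 * ?f 1 s \<omega>\<bar>"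
      unfolding flux_def by (simp only: add_0 abs_triangle_ineq4)
    also have "\<dots> \<le> \<bar>?f 0 s \<omega>\<bar> * dual_mass \<omega> (?tail n) s 1 + \<bar>?f 1 s \<omega>\<bar> * dual_mass \<omega> (?tail n) s 0"
      unfolding abs_mult[of _ "dual_mass _ _ _ _"] abs_mult[of "dual_mass _ _ _ _"]
        abs_of_nonneg[OF dual_mass_nonneg[OF \<omega>]] mult.commute[of "dual_mass _ _ _ _"]
      by (intro add_mono mult_left_mono mono) auto
    finally show ?thesis by (simp add: G_def Q_def indicator_def)
  qed
  have Gi: "integrable (lborel \<Otimes>\<^sub>M M) (case_prod (G n))" for n
  proof (rule Bochner_Integration.integrable_bound[OF Qi[of n] Gm[of n] AE_I2])
    fix p :: "real \<times> 'a" assume "p \<in> space (lborel \<Otimes>\<^sub>M M)"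
    then show "norm (case_prod (G n) p) \<le> norm (Q n p)"
      using GQ[of "snd p" n "fst p"] by (auto simp: space_pair_measure split_beta)
  qed
  define R where "R n \<omega> = (\<integral>s. G n s \<omega> \<partial>lborel)" for n \<omega>
  have Ri: "integrable M (R n)" for n
    unfolding R_def by (rule L.integrable_snd[OF Gi])
  have flux_R: "(LBINT s:{0..T}. flux \<phi> Y (z n) s \<omega>) = R n (\<tau> 0 (z n) \<omega>)" if "\<omega> \<in> space M" for n \<omega>
  proof -
    have "(\<lambda>y. y + z n) ` Z n = Y" by (force simp: Z_def image_image)
    then show ?thesis
      using flux_shift[OF that, of \<phi> "z n" "Z n" 0] by (simp add: R_def G_def set_lebesgue_integral_def)
  qed
  show "integrable M (\<lambda>\<omega>. LBINT s:{0..T}. flux \<phi> Y (z n) s \<omega>)" for n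
    using integrable_shift[OF Ri, of n 0 "z n"] flux_R by (simp cong: Bochner_Integration.integrable_cong)
  have "(\<integral>\<omega>. norm (LBINT s:{0..T}. flux \<phi> Y (z n) s \<omega>) \<partial>M) \<le> (\<integral>p. Q n p \<partial>(lborel \<Otimes>\<^sub>M M))" for n
  proof -
    have ab: "integrable (lborel \<Otimes>\<^sub>M M) (\<lambda>(s, \<omega>). \<bar>G n s \<omega>\<bar>)"
      using integrable_abs[OF Gi[of n]] by (simp add: case_prod_beta')
    have "(\<integral>\<omega>. norm (LBINT s:{0..T}. flux \<phi> Y (z n) s \<omega>) \<partial>M) = (\<integral>\<omega>. \<bar>R n (\<tau> 0 (z n) \<omega>)\<bar> \<partial>M)"
      using flux_R by (simp cong: Bochner_Integration.integral_cong)
    also have "\<dots> = (\<integral>\<omega>. \<bar>R n \<omega>\<bar> \<partial>M)"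
      using Ri[of n] by (intro integral_shift[where g = "\<lambda>\<omega>. \<bar>R n \<omega>\<bar>"]) auto
    also have "\<dots> \<le> (\<integral>\<omega>. (\<integral>s. \<bar>G n s \<omega>\<bar> \<partial>lborel) \<partial>M)"
      using integral_norm_bound[of lborel "\<lambda>s. G n s _"]
      by (intro integral_mono integrable_abs Ri L.integrable_snd[OF ab]) (simp add: R_def)
    also have "\<dots> = (\<integral>p. (case p of (s, \<omega>) \<Rightarrow> \<bar>G n s \<omega>\<bar>) \<partial>(lborel \<Otimes>\<^sub>M M))"
      by (rule L.integral_snd[OF ab])
    also have "\<dots> \<le> (\<integral>p. Q n p \<partial>(lborel \<Otimes>\<^sub>M M))"
      using GQ by (intro integral_mono ab Qi) (auto simp: space_pair_measure)
    finally show ?thesis .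
  qed
  then show "(\<lambda>n. \<integral>\<omega>. norm (LBINT s:{0..T}. flux \<phi> Y (z n) s \<omega>) \<partial>M) \<longlonglongrightarrow> 0"
    by (intro real_tendsto_sandwich[OF _ _ tendsto_const Q0] always_eventually) auto
qed

lemma has_sum_transported_mass:
  assumes \<omega>: "\<omega> \<in> space M" and pos: "\<And>x. 0 \<le> \<phi> (\<tau> T x \<omega>)" and r: "strict_mono r"
    and lim: "(\<lambda>n. \<Sum>x\<in>X \<inter> {- int (r n)..int (r n)}. \<phi> (\<tau> T x \<omega>) * dual_mass \<omega> Y T x) \<longlonglongrightarrow> L"
  shows "((\<lambda>(x, y). \<phi> (\<tau> T x \<omega>) * dual_kernel b \<omega> T x 0 y) has_sum L) (X \<times> Y)"
proof -
  have outer: "((\<lambda>x. \<phi> (\<tau> T x \<omega>) * dual_mass \<omega> Y T x) has_sum L) X"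
    using r lim by (intro has_sum_of_window_subsequence mult_nonneg_nonneg pos dual_mass_nonneg[OF \<omega>])
  have inner: "((\<lambda>y. case (x, y) of (x, y) \<Rightarrow> \<phi> (\<tau> T x \<omega>) * dual_kernel b \<omega> T x 0 y) has_sum
      \<phi> (\<tau> T x \<omega>) * dual_mass \<omega> Y T x) Y" for x
    using has_sum_cmult_right[OF has_sum_infsum[OF dual_kernel_summable[OF \<omega>]]]
    by (simp add: dual_mass_def)
  show ?thesis
    using has_sum_imp_summable[OF outer] pos dual_kernel_nonneg[OF \<omega>]
    by (intro has_sum_SigmaI[OF inner outer] summable_on_SigmaI[OF inner]) auto
qed

end

section \<open>The integrated flux as a mass transport\<close>

theorem proposition6p1:
  fixes M :: "'a measure" and b :: "real \<Rightarrow> int \<Rightarrow> 'a \<Rightarrow> real"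
    and \<tau> :: "real \<Rightarrow> int \<Rightarrow> 'a \<Rightarrow> 'a" and \<phi> :: "'a \<Rightarrow> real" and t :: real
  assumes "dynamical_conductances M b \<tau>"
    and "integrable M (b 0 0)"
    and "integrable M (\<lambda>\<omega>. inverse (b 0 0 \<omega>))"
    and "phi_density M b \<tau> \<phi>"
    and "0 \<le> t"
  shows "AE \<omega> in M.
    (\<lambda>(x, y). \<phi> (\<tau> t x \<omega>) * dual_kernel b \<omega> t x 0 y) summable_on ({..<0} \<times> {0..}) \<and>
    (\<lambda>(x, y). \<phi> (\<tau> t x \<omega>) * dual_kernel b \<omega> t x 0 y) summable_on ({0..} \<times> {..<0}) \<and>
    chi b \<tau> \<phi> t \<omega> =
      (\<Sum>\<^sub>\<infinity>(x, y)\<in>{..<0} \<times> {0..}. \<phi> (\<tau> t x \<omega>) * dual_kernel b \<omega> t x 0 y) -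
      (\<Sum>\<^sub>\<infinity>(x, y)\<in>{0..} \<times> {..<0}. \<phi> (\<tau> t x \<omega>) * dual_kernel b \<omega> t x 0 y)"
proof -
  interpret dynamical_conductances M b \<tau> by fact
  have [measurable]: "\<phi> \<in> borel_measurable M" and pos: "AE \<omega> in M. 0 < \<phi> \<omega>"
    and \<phi>: "integrable M \<phi>" and sq: "integrable M (\<lambda>\<omega>. b 0 0 \<omega> * (\<phi> \<omega>)\<^sup>2)"
    and id: "\<And>T. T > 0 \<Longrightarrow> AE \<omega> in M. ((\<lambda>x. \<phi> (\<tau> T x \<omega>) * dual_kernel b \<omega> T x 0 0) has_sum \<phi> \<omega>) UNIV"
    and eq: "AE \<omega> in M. \<forall>x. continuous_on UNIV (\<lambda>t. \<phi> (\<tau> t x \<omega>)) \<and>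
        (\<forall>s t. s \<le> t \<longrightarrow> \<phi> (\<tau> t x \<omega>) - \<phi> (\<tau> s x \<omega>) =
           (LBINT u:{s..t}. - b u (x + 1) \<omega> * \<phi> (\<tau> u (x + 1) \<omega>)
                            - b u (x - 1) \<omega> * \<phi> (\<tau> u (x - 1) \<omega>)
                            + 2 * b u x \<omega> * \<phi> (\<tau> u x \<omega>)))"
    using assms(4) unfolding phi_density_def by blast+
  have f: "integrable M (\<lambda>\<omega>. b 0 0 \<omega> * \<phi> \<omega>)"
  proof (rule Bochner_Integration.integrable_bound[OF Bochner_Integration.integrable_add[OF assms(2) sq]])
    show "AE \<omega> in M. norm (b 0 0 \<omega> * \<phi> \<omega>) \<le> norm (b 0 0 \<omega> + b 0 0 \<omega> * (\<phi> \<omega>)\<^sup>2)"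
    proof (rule AE_I2)
      fix \<omega> assume "\<omega> \<in> space M"
      then have b: "0 < b 0 0 \<omega>" by (rule conductance_pos)
      \<comment> \<open>The linear bound behind the integrability of the intensity; it absorbs \<open>b \<phi>\<close> into \<open>b\<close> and \<open>b \<phi>\<^sup>2\<close>.\<close>
      have "0 \<le> (\<bar>\<phi> \<omega>\<bar> - 1)\<^sup>2" by simp
      then have "\<bar>\<phi> \<omega>\<bar> \<le> 1 + (\<phi> \<omega>)\<^sup>2"
        using zero_le_power2[of "\<phi> \<omega>"] by (simp add: power2_eq_square algebra_simps)
      then have "b 0 0 \<omega> * \<bar>\<phi> \<omega>\<bar> \<le> b 0 0 \<omega> * (1 + (\<phi> \<omega>)\<^sup>2)" using b by simp
      then show "norm (b 0 0 \<omega> * \<phi> \<omega>) \<le> norm (b 0 0 \<omega> + b 0 0 \<omega> * (\<phi> \<omega>)\<^sup>2)"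
        using b by (simp add: abs_mult distrib_left)
    qed
  qed measurable
  have mass: "AE \<omega> in M. \<forall>x. dual_mass \<omega> UNIV t x = 1"
  proof (cases "t = 0")
    case True then show ?thesis by (auto simp: dual_mass_start)
  next
    case False
    with assms(5) have "0 < t" by simp
    then show ?thesis by (intro mass_conserved[OF \<phi> pos id])
  qed
  have pos': "AE \<omega> in M. \<forall>x. 0 < \<phi> (\<tau> t x \<omega>)"
    unfolding AE_all_countable by (intro allI AE_shift[OF pos])
  \<comment> \<open>The outer boundary of the window \<open>{-n..-1}\<close> is the bond from \<open>-n-1\<close> to \<open>-n\<close>.\<close>
  obtain r where r: "strict_mono r"
    and r0: "AE \<omega> in M. (\<lambda>n. LBINT s:{0..t}. flux \<phi> {0..} (- int (r n) - 1) s \<omega>) \<longlonglongrightarrow> 0"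
    using boundary_flux_vanishes[OF _ f, of "{0..}" "\<lambda>n. - int n - 1" t] by auto
  \<comment> \<open>The outer boundary of the window \<open>{0..n}\<close> is the bond from \<open>n\<close> to \<open>n+1\<close>.\<close>
  obtain q where q: "strict_mono q"
    and q0: "AE \<omega> in M. (\<lambda>n. LBINT s:{0..t}. flux \<phi> {..<0} (int (q n)) s \<omega>) \<longlonglongrightarrow> 0"
    using boundary_flux_vanishes[OF _ f, of "{..<0}" "\<lambda>n. int n" t] by auto
  show ?thesis
    using mass pos' eq r0 q0 AE_space
  proof eventually_elim
    case (elim \<omega>)
    let ?w = "\<lambda>(x, y). \<phi> (\<tau> t x \<omega>) * dual_kernel b \<omega> t x 0 y"
    let ?J = "\<lambda>Y x. LBINT s:{0..t}. flux \<phi> Y x s \<omega>"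
    have \<omega>: "\<omega> \<in> space M" by fact
    have cont: "continuous_on UNIV (\<lambda>s. \<phi> (\<tau> s x \<omega>))" for x using elim(3) by blast
    have fi: "set_integrable lborel {0..t} (\<lambda>u. b u x \<omega> * \<phi> (\<tau> u x \<omega>))" for x
    proof -
      have "compact ((\<lambda>s. \<phi> (\<tau> s x \<omega>)) ` {0..t})"
        by (intro compact_continuous_image continuous_on_subset[OF cont]) auto
      then have "bounded ((\<lambda>s. \<phi> (\<tau> s x \<omega>)) ` {0..t})"
        by (rule compact_imp_bounded)
      then obtain C where "\<forall>y\<in>(\<lambda>s. \<phi> (\<tau> s x \<omega>)) ` {0..t}. norm y \<le> C"
        unfolding bounded_iff by blast
      then have "\<bar>\<phi> (\<tau> s x \<omega>)\<bar> \<le> C" if "s \<in> {0..t}" for s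
        using that by simp
      then have "set_integrable lborel {0..t} (\<lambda>u. \<phi> (\<tau> u x \<omega>) * b u x \<omega>)"
        by (intro set_integrable_bounded_mult conductance_locally_integrable[OF \<omega>]
            borel_measurable_continuous_onI cont)
      then show ?thesis by (simp add: mult.commute)
    qed
    have dens: "has_lebesgue_derivative t (\<lambda>s. \<phi> (\<tau> s x \<omega>))
       (\<lambda>u. - b u (x + 1) \<omega> * \<phi> (\<tau> u (x + 1) \<omega>) - b u (x - 1) \<omega> * \<phi> (\<tau> u (x - 1) \<omega>)
            + 2 * b u x \<omega> * \<phi> (\<tau> u x \<omega>))" (is "has_lebesgue_derivative t _ ?d") for x
      unfolding has_lebesgue_derivative_def
    proof (intro conjI ballI)
      have "set_integrable lborel {0..t} (\<lambda>u. (- 1) * (b u (x + 1) \<omega> * \<phi> (\<tau> u (x + 1) \<omega>))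
          - b u (x - 1) \<omega> * \<phi> (\<tau> u (x - 1) \<omega>) + 2 * (b u x \<omega> * \<phi> (\<tau> u x \<omega>)))"
        by (intro set_integral_add(1) set_integral_diff(1) set_integrable_mult_right fi)
      then show "set_integrable lborel {0..t} ?d" by (simp add: mult.assoc)
      fix s assume "s \<in> {0..t}"
      then have "\<phi> (\<tau> s x \<omega>) - \<phi> (\<tau> 0 x \<omega>) = (LBINT u:{0..s}. ?d u)"
        using elim(3) by simp
      then show "\<phi> (\<tau> s x \<omega>) = \<phi> (\<tau> 0 x \<omega>) + (LBINT u:{0..s}. ?d u)" by linarith
    qed
    note green = green_identity[OF \<omega> assms(5) _ _ fi dens]
    have nn: "0 \<le> \<phi> (\<tau> t x \<omega>)" for x using elim(2) by (simp add: less_imp_le)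
    have "{..<0} \<inter> {- int n..int n} = {- int n..- 1}" for n by auto
    then have "(\<lambda>n. \<Sum>x\<in>{..<0} \<inter> {- int (r n)..int (r n)}. \<phi> (\<tau> t x \<omega>) * dual_mass \<omega> {0..} t x) =
        (\<lambda>n. ?J {0..} (- 1) - ?J {0..} (- int (r n) - 1))"
      by (simp add: green)
    also have "\<dots> \<longlonglongrightarrow> ?J {0..} (- 1) - 0" by (intro tendsto_diff tendsto_const elim(4))
    finally have left: "(?w has_sum ?J {0..} (- 1)) ({..<0} \<times> {0..})"
      by (intro has_sum_transported_mass[where \<phi> = \<phi> and T = t, OF \<omega> nn r]) simp
    have "{0..} \<inter> {- int n..int n} = {0..int n}" for n by auto
    then have "(\<lambda>n. \<Sum>x\<in>{0..} \<inter> {- int (q n)..int (q n)}. \<phi> (\<tau> t x \<omega>) * dual_mass \<omega> {..<0} t x) =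
        (\<lambda>n. ?J {..<0} (int (q n)) - ?J {..<0} (0 - 1))"
      by (subst green[symmetric]) auto
    also have "\<dots> \<longlonglongrightarrow> 0 - ?J {..<0} (0 - 1)" by (intro tendsto_diff tendsto_const elim(5))
    finally have right: "(?w has_sum - ?J {..<0} (- 1)) ({0..} \<times> {..<0})"
      by (intro has_sum_transported_mass[where \<phi> = \<phi> and T = t, OF \<omega> nn q]) simp
    have "- {0::int..} = {..<0}" by auto
    then have "?J {0..} (- 1) + ?J {..<0} (- 1) =
        (LBINT s:{0..t}. b s (- 1) \<omega> * \<phi> (\<tau> s (- 1) \<omega>) - b s 0 \<omega> * \<phi> (\<tau> s 0 \<omega>))"
      using flux_complementary_sum[OF \<omega> _ fi, of "{0..}" "- 1"] elim(1) by simp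
    also have "\<dots> = chi b \<tau> \<phi> t \<omega>"
      unfolding chi_def set_lebesgue_integral_def
      by (subst Bochner_Integration.integral_minus[symmetric])
        (intro Bochner_Integration.integral_cong, auto simp: algebra_simps)
    finally have "chi b \<tau> \<phi> t \<omega> = ?J {0..} (- 1) - (- ?J {..<0} (- 1))" by simp
    then show ?case
      using has_sum_imp_summable[OF left] has_sum_imp_summable[OF right] infsumI[OF left] infsumI[OF right]
      by simp
  qed
qed

end
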